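(* Let $K\ge1$ be any fixed integer, let $\omega_1,\dots,\omega_K>0$, and let $N_B^{hard}$ denote the hard-thresholding scheme with threshold $B$. Then the scheme $N_B^{hard}$ with $B=A$ asymptotically minimizes, up to first order, the detection delay for each and every post-change mean vector $\mu\in\Omega$ subject to the false alarm constraint, as $A\to\infty$. That is, $\mathbf{E}_\infty(N_A^{hard})\ge A$ for every $A>0$, and for every $\mu\in\Omega$, $$\lim_{A\to\infty}\frac{D_\mu(N_A^{hard})}{\inf\{D_\mu(T): T \text{ a stopping time with } \mathbf{E}_\infty(T)\ge A\}}=1.$$
   Context: Observations: $X_{k,n}$, $k=1,\dots,K$, $n=1,2,\dots$, are independent real random variables. For $\nu\in\{1,2,\dots\}$ and $\mu\in\mathbb{R}^K$, under $\mathbf{P}_{\mu,\nu}$ (expectation $\mathbf{E}_{\mu,\nu}$), $X_{k,n}\sim N(0,1)$ for $n<\nu$ and $X_{k,n}\sim N(\mu_k,1)$ for $n\ge\nu$. Under $\mathbf{P}_\infty$ (expectation $\mathbf{E}_\infty$) all $X_{k,n}\sim N(0,1)$ (no change). Let $\mathcal{F}_n$ be the $\sigma$-algebra generated by $X_{k,i}$, $1\le k\le K$, $i\le n$; stopping times are with respect to $(\mathcal{F}_n)$. The worst-case detection delay of a stopping time $T$ is $$D_\mu(T)=\sup_{1\le\nu<\infty}\operatorname{ess\,sup}\,\mathbf{E}_{\mu,\nu}\big(T-\nu+1\mid T\ge\nu,\mathcal{F}_{\nu-1}\big).$$ The post-change hypothesis set is $$\Omega=\Big\{\mu\in\mathbb{R}^K:\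 \mu\ne\mathbf{0},\ \sum_{k=1}^K|\mu_k|\,1\{|\mu_k|\le\omega_k\}=0\Big\},$$ i.e. for each $k$ either $\mu_k=0$ or $|\mu_k|>\omega_k$, and not all $\mu_k$ are $0$. Hard-thresholding scheme: let $f_\theta$ be the density of $N(\theta,1)$. For $\ell>m\ge1$ let $\bar X_{k,m,\ell}=\frac{X_{k,m}+\cdots+X_{k,\ell-1}}{\ell-m}$, and let $\hat\mu_{k,m,\ell}=\bar X_{k,m,\ell}$ if $|\bar X_{k,m,\ell}|\ge\omega_k$, and $\hat\mu_{k,m,\ell}=0$ otherwise; also $\hat\mu_{k,m,m}=0$. Put $$\Lambda_{n,m}=\prod_{\ell=m}^n\prod_{k=1}^K\frac{f_{\hat\mu_{k,m,\ell}}(X_{k,\ell})}{f_{0}(X_{k,\ell})}\quad(1\le m\le n),\qquad R_n=\sum_{m=1}^n\Lambda_{n,m},\qquad N_B^{hard}=\inf\{n\ge1:R_n\ge B\}$$ (so $\Lambda_{n,n}=1$). *)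

theory Defs
  imports "HOL-Probability.Probability"
begin

(* X k n is the n-th observation of stream k, for n = 1, 2, ...  The value X k 0 plays no role.
   P \<mu> \<nu> and Pinf all live on one measurable space. *)
locale change_point_model =
  fixes X :: "'k::finite \<Rightarrow> nat \<Rightarrow> 'a \<Rightarrow> real"
    and P :: "real ^ 'k \<Rightarrow> nat \<Rightarrow> 'a measure"
    and Pinf :: "'a measure"
  assumes prob_space_Pinf: "prob_space Pinf"
    and prob_space_P: "1 \<le> \<nu> \<Longrightarrow> prob_space (P \<mu> \<nu>)"
    and sets_P: "1 \<le> \<nu> \<Longrightarrow> sets (P \<mu> \<nu>) = sets Pinf"
    and indep_Pinf:
      "prob_space.indep_vars Pinf (\<lambda>_. borel) (\<lambda>(k, n). X k n) (UNIV \<times> {1..})"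
    and indep_P:
      "1 \<le> \<nu> \<Longrightarrow>
        prob_space.indep_vars (P \<mu> \<nu>) (\<lambda>_. borel) (\<lambda>(k, n). X k n) (UNIV \<times> {1..})"
    and normal_Pinf:
      "1 \<le> n \<Longrightarrow> distributed Pinf lborel (X k n) (normal_density 0 1)"
    and normal_P_before:
      "1 \<le> n \<Longrightarrow> n < \<nu> \<Longrightarrow> distributed (P \<mu> \<nu>) lborel (X k n) (normal_density 0 1)"
    and normal_P_after:
      "1 \<le> \<nu> \<Longrightarrow> \<nu> \<le> n \<Longrightarrow> distributed (P \<mu> \<nu>) lborel (X k n) (normal_density (\<mu> $ k) 1)"

(* Indexing by enat (with the \<sigma>-algebra of all observations at \<infinity>) makes the library's stopping_time
   applicable to [0, \<infinity>]-valued times: the condition at \<infinity> is void, and the conditions at finite n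
   are the usual ones. Only the space of the measure M is used. *)
definition obs_filtration ::
  "'a measure \<Rightarrow> ('k \<Rightarrow> nat \<Rightarrow> 'a \<Rightarrow> real) \<Rightarrow> enat \<Rightarrow> 'a measure" where
  "obs_filtration M X t =
     sigma (space M)
       {X k i -` B \<inter> space M | k i B. 1 \<le> i \<and> enat i \<le> t \<and> B \<in> sets borel}"

(* Q \<nu> is the law under which the change occurs at time \<nu>. Conditioning on the event T \<ge> \<nu> is done by
   passing to Q \<nu> ( . | T \<ge> \<nu>); if that event is null, uniform_measure is the null measure and the
   essential supremum is 0. Under the conditioned measure, the truncation of T - \<nu> at 0 occurs only
   on a null set. *)
definition detection_delay ::
  "('k \<Rightarrow> nat \<Rightarrow> 'a \<Rightarrow> real) \<Rightarrow> (nat \<Rightarrow> 'a measure) \<Rightarrow> ('a \<Rightarrow> enat) \<Rightarrow> ennreal" where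
  "detection_delay X Q T =
     (SUP \<nu>\<in>{1..}.
        let M = uniform_measure (Q \<nu>) {x \<in> space (Q \<nu>). enat \<nu> \<le> T x}
        in esssup M
             (nn_cond_exp M (obs_filtration M X (enat (\<nu> - 1)))
                (\<lambda>x. ennreal_of_enat (T x - enat \<nu> + 1))))"

definition post_change_set :: "('k::finite \<Rightarrow> real) \<Rightarrow> (real ^ 'k) set" where
  "post_change_set \<omega> =
     {\<mu>. \<mu> \<noteq> 0 \<and> (\<Sum>k\<in>UNIV. \<bar>\<mu> $ k\<bar> * of_bool (\<bar>\<mu> $ k\<bar> \<le> \<omega> k)) = 0}"

(* In the definitions below, y k n is the realized value of the n-th observation of stream k. *)

definition window_mean :: "('k \<Rightarrow> nat \<Rightarrow> real) \<Rightarrow> 'k \<Rightarrow> nat \<Rightarrow> nat \<Rightarrow> real" where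
  "window_mean y k m l = (\<Sum>i\<in>{m..<l}. y k i) / real (l - m)"

definition hard_estimate ::
  "('k \<Rightarrow> real) \<Rightarrow> ('k \<Rightarrow> nat \<Rightarrow> real) \<Rightarrow> 'k \<Rightarrow> nat \<Rightarrow> nat \<Rightarrow> real" where
  "hard_estimate \<omega> y k m l =
     (if m < l \<and> \<omega> k \<le> \<bar>window_mean y k m l\<bar> then window_mean y k m l else 0)"

definition likelihood_ratio ::
  "('k::finite \<Rightarrow> real) \<Rightarrow> ('k \<Rightarrow> nat \<Rightarrow> real) \<Rightarrow> nat \<Rightarrow> nat \<Rightarrow> real" where
  "likelihood_ratio \<omega> y n m =
     (\<Prod>l\<in>{m..n}. \<Prod>k\<in>UNIV.
        normal_density (hard_estimate \<omega> y k m l) 1 (y k l) / normal_density 0 1 (y k l))"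

definition SR_statistic :: "('k::finite \<Rightarrow> real) \<Rightarrow> ('k \<Rightarrow> nat \<Rightarrow> real) \<Rightarrow> nat \<Rightarrow> real" where
  "SR_statistic \<omega> y n = (\<Sum>m\<in>{1..n}. likelihood_ratio \<omega> y n m)"

definition N_hard ::
  "('k::finite \<Rightarrow> real) \<Rightarrow> ('k \<Rightarrow> nat \<Rightarrow> 'a \<Rightarrow> real) \<Rightarrow> real \<Rightarrow> 'a \<Rightarrow> enat" where
  "N_hard \<omega> X B x =
     (INF n\<in>{n. 1 \<le> n \<and> B \<le> SR_statistic \<omega> (\<lambda>k i. X k i x) n}. enat n)"

end

theory Submission
  imports Defs "HOL-Real_Asymp.Real_Asymp"
begin

text \<open>
  Let \<open>I = |\<mu>|\<^sup>2 / 2\<close> be the relative entropy of one post-change observation vector with respect to a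
  pre-change one. Both the delay of the hard-thresholding scheme with threshold \<open>A\<close> and the smallest
  delay that the false alarm constraint permits are \<open>(1 + o(1)) ln A / I\<close>; since the scheme satisfies
  the constraint, their ratio is at least 1 and tends to 1.

  False alarms. An estimate entering the likelihood ratio at time \<open>l\<close> depends on earlier observations
  only, so under no change every \<open>\<Lambda>\<^sub>n\<^sub>,\<^sub>m\<close> is a martingale in \<open>n\<close> that starts at 1, and \<open>R\<^sub>n - n\<close> is a
  martingale. Since \<open>R\<^sub>N \<ge> A\<close>, optional stopping gives \<open>E N \<ge> A\<close> (\<open>SR_statistic_drift\<close>, \<open>N_hard_false_alarm\<close>).

  Lower bound. If \<open>E T \<ge> A\<close> without a change, then \<open>T\<close> must have a small hazard somewhere: there is a \<open>\<nu>\<close>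
  such that, given \<open>T \<ge> \<nu>\<close>, it stops within the next \<open>m\<close> steps with probability at most \<open>2 m / A\<close>
  (\<open>exists_low_hazard_time\<close>). A change at this \<open>\<nu>\<close> multiplies the probability of stopping
  within these \<open>m\<close> steps by at most \<open>exp ((1 + e) I m)\<close>, up to a part on which the likelihood ratio
  is atypically large (\<open>P_mass_bound\<close>). For \<open>m = (1 - e) ln A / I\<close> the resulting probability tends to 0,
  so \<open>T\<close> needs more than \<open>m\<close> steps after the change. The atypical part is controlled by the moment of
  order \<open>1 + s\<close> of the likelihood ratio, and the power \<open>1 + s\<close> of a Gaussian likelihood ratio is a
  constant times the likelihood ratio for the mean \<open>(1 + s) \<mu>\<close>, which again belongs to the model.

  Upper bound. As \<open>R\<^sub>n \<ge> \<Lambda>\<^sub>n\<^sub>,\<^sub>\<nu>\<close>, the scheme stops no later than the one-sided test that waits for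
  \<open>\<Lambda>\<^sub>n\<^sub>,\<^sub>\<nu> \<ge> A\<close>. This test uses observations from \<open>\<nu>\<close> on, so it is independent of the past and its expected
  duration bounds the conditional delay given any past (\<open>detection_delay_N_hard_le\<close>). The increments of
  \<open>ln \<Lambda>\<^sub>n\<^sub>,\<^sub>\<nu>\<close> have conditional mean \<open>I - |h\<^sub>l - \<mu>|\<^sup>2 / 2\<close>, where \<open>h\<^sub>l\<close> is the current estimate. Each \<open>\<mu>\<^sub>k\<close>
  either vanishes or exceeds its threshold in absolute value, and therefore the thresholded estimate errs by at most a
  constant times the error of the sample mean (\<open>hard_estimate_error\<close>); the fourth moments of the
  latter are summable. A Wald-type comparison of the stopped sum of increments with its expectation
  then bounds the expected duration by \<open>(ln A + C) / ((1 - \<epsilon>) I)\<close>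
  (\<open>stopped_sum_bound\<close>, \<open>expected_running_time_bound\<close>).
\<close>

section \<open>Independence of past and future observations\<close>

lemma space_obs_filtration [simp]: "space (obs_filtration M X t) = space M"
  by (simp add: obs_filtration_def space_measure_of_conv)

lemma sets_obs_filtration:
  "sets (obs_filtration M X t) =
     sigma_sets (space M) {X k i -` B \<inter> space M | k i B. 1 \<le> i \<and> enat i \<le> t \<and> B \<in> sets borel}"
  unfolding obs_filtration_def by (rule sets_measure_of) auto

lemma sets_obs_filtration_mono:
  "s \<le> t \<Longrightarrow> sets (obs_filtration M X s) \<subseteq> sets (obs_filtration M X t)"
  unfolding sets_obs_filtration by (rule sigma_sets_mono') (auto intro: order_trans)

lemma obs_filtration_cong: "space M = space N \<Longrightarrow> obs_filtration M X t = obs_filtration N X t"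
  by (simp add: obs_filtration_def)

lemma measurable_obs_filtration:
  assumes "1 \<le> i" "enat i \<le> t"
  shows "X k i \<in> borel_measurable (obs_filtration M X t)"
proof (rule measurableI)
  fix B :: "real set" assume "B \<in> sets borel"
  then show "X k i -` B \<inter> space (obs_filtration M X t) \<in> sets (obs_filtration M X t)"
    unfolding sets_obs_filtration space_obs_filtration using assms by (intro sigma_sets.Basic) auto
qed auto

text \<open>
  The no-change measure and each of the measures with a change are instances, with \<open>\<theta> k n\<close> the mean of
  \<open>X k n\<close>. What depends only on the means is proved here once for all of them.
\<close>
locale gaussian_streams = prob_space M
  for M :: "'a measure" and X :: "'k::finite \<Rightarrow> nat \<Rightarrow> 'a \<Rightarrow> real" and \<theta> :: "'k \<Rightarrow> nat \<Rightarrow> real" +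
  assumes indep: "indep_vars (\<lambda>_. borel) (\<lambda>(k, n). X k n) (UNIV \<times> {1..})"
    and normal: "1 \<le> n \<Longrightarrow> distributed M lborel (X k n) (normal_density (\<theta> k n) 1)"
begin

lemma X_measurable: "1 \<le> n \<Longrightarrow> X k n \<in> borel_measurable M"
  using distributed_measurable[OF normal] by simp

lemma subalgebra_obs: "subalgebra M (obs_filtration M X t)"
proof -
  have "sets (obs_filtration M X t) \<subseteq> sets M"
    unfolding sets_obs_filtration
    by (rule sets.sigma_sets_subset) (auto intro!: measurable_sets X_measurable)
  then show ?thesis by (simp add: subalgebra_def)
qed

lemmas from_obs = measurable_from_subalg[OF subalgebra_obs]

lemma obs_sets: "E \<in> sets (obs_filtration M X t) \<Longrightarrow> E \<in> sets M"
  using subalgebra_obs by (auto simp: subalgebra_def)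

definition future :: "nat \<Rightarrow> 'a measure" where
  "future n = sigma (space M) {X k i -` B \<inter> space M | k i B. n < i \<and> B \<in> sets borel}"

lemma space_future [simp]: "space (future n) = space M"
  by (simp add: future_def space_measure_of_conv)

lemma sets_future:
  "sets (future n) = sigma_sets (space M) {X k i -` B \<inter> space M | k i B. n < i \<and> B \<in> sets borel}"
  unfolding future_def by (rule sets_measure_of) auto

lemma measurable_future:
  assumes "n < i"
  shows "X k i \<in> borel_measurable (future n)"
proof (rule measurableI)
  fix B :: "real set" assume "B \<in> sets borel"
  then show "X k i -` B \<inter> space (future n) \<in> sets (future n)"
    unfolding sets_future space_future using assms by (intro sigma_sets.Basic) auto
qed auto

text \<open>
  The generators of the two \<open>\<sigma>\<close>-algebras belong to disjoint blocks of the independent family.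
\<close>
lemma indep_past_future: "indep_set (sets (obs_filtration M X (enat n))) (sets (future n))"
proof -
  let ?E = "\<lambda>(k, i). {X k i -` B \<inter> space M | B. B \<in> sets borel}"
  let ?I = "case_bool (UNIV \<times> {1..n}) (UNIV \<times> {n<..}) :: bool \<Rightarrow> ('k \<times> nat) set"
  have *: "indep_sets ?E (UNIV \<times> {1..})"
    using indep unfolding indep_vars_def2 by (auto simp: case_prod_unfold)
  have "indep_sets (\<lambda>j. sigma_sets (space M) (\<Union>i\<in>?I j. ?E i)) UNIV"
  proof (rule indep_sets_collect_sigma)
    show "indep_sets ?E (\<Union>j\<in>UNIV. ?I j)"
      by (rule indep_sets_mono_index[OF _ *]) (auto split: bool.splits)
    show "Int_stable (?E i)" for i
      by (cases i) (auto simp: Int_stable_def vimage_Int[symmetric], metis vimage_Int sets.Int Int_assoc Int_left_commute Int_absorb)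
    show "disjoint_family_on ?I UNIV"
      by (auto simp: disjoint_family_on_def split: bool.splits)
  qed
  moreover have "(\<lambda>j. sigma_sets (space M) (\<Union>i\<in>?I j. ?E i)) =
      case_bool (sets (obs_filtration M X (enat n))) (sets (future n))"
  proof (rule ext)
    fix j show "sigma_sets (space M) (\<Union>i\<in>?I j. ?E i) =
       case_bool (sets (obs_filtration M X (enat n))) (sets (future n)) j"
    proof (cases j)
      case True
      have "(\<Union>i\<in>?I True. ?E i) = {X k i -` B \<inter> space M | k i B. 1 \<le> i \<and> enat i \<le> enat n \<and> B \<in> sets borel}"
        by force
      with True show ?thesis by (simp add: sets_obs_filtration)
    next
      case False
      have "(\<Union>i\<in>?I False. ?E i) = {X k i -` B \<inter> space M | k i B. n < i \<and> B \<in> sets borel}"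
        by force
      with False show ?thesis by (simp add: sets_future)
    qed
  qed
  ultimately show ?thesis unfolding indep_set_def by simp
qed

lemma sets_future_events: "E \<in> sets (future n) \<Longrightarrow> E \<in> sets M"
  using indep_setD_ev2[OF indep_past_future] by auto

lemma indep_var_past_future:
  assumes f: "f \<in> measurable (obs_filtration M X (enat n)) S" and g: "g \<in> measurable (future n) T"
  shows "indep_var S f T g"
proof -
  have rv: "random_variable S f" "random_variable T g"
    using from_obs[OF f] g indep_setD_ev2[OF indep_past_future, of n] by (auto simp: measurable_def)
  have 1: "sigma_sets (space M) {f -` A \<inter> space M |A. A \<in> sets S} \<subseteq> sets (obs_filtration M X (enat n))"
    using measurable_sets[OF f] by (intro sets.sigma_sets_subset[of _ "obs_filtration M X (enat n)", simplified]) auto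
  have 2: "sigma_sets (space M) {g -` A \<inter> space M |A. A \<in> sets T} \<subseteq> sets (future n)"
    using measurable_sets[OF g] by (intro sets.sigma_sets_subset[of _ "future n", simplified]) auto
  have "indep_set (sigma_sets (space M) {f -` A \<inter> space M |A. A \<in> sets S})
      (sigma_sets (space M) {g -` A \<inter> space M |A. A \<in> sets T})"
    using 1 2 indep_setD_ev1[OF indep_past_future, of n] indep_setD_ev2[OF indep_past_future, of n]
    by (intro indep_setI indep_setD[OF indep_past_future[of n]]) blast+
  with rv show ?thesis unfolding indep_var_eq by blast
qed

text \<open>
  Integrating over an independent copy of the future for a fixed past is how expectations conditional
  on the past are computed below. Taking the identity as the random variable that represents each
  \<open>\<sigma>\<close>-algebra avoids having to factor functions of the past through the observations.
\<close>
lemma nn_integral_past_future: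
  assumes F: "F \<in> borel_measurable (obs_filtration M X (enat n) \<Otimes>\<^sub>M future n)"
  shows "(\<integral>\<^sup>+x. F (x, x) \<partial>M) = (\<integral>\<^sup>+x. \<integral>\<^sup>+y. F (x, y) \<partial>M \<partial>M)"
proof -
  let ?P = "obs_filtration M X (enat n)" and ?F = "future n"
  have p: "(\<lambda>x. x) \<in> measurable M ?P" and f: "(\<lambda>x. x) \<in> measurable M ?F"
    using obs_sets sets_future_events
    by (auto intro!: measurableI simp: sets.Int_space_eq2)
  interpret P: prob_space "distr M ?P (\<lambda>x. x)" by (rule prob_space_distr[OF p])
  interpret F: prob_space "distr M ?F (\<lambda>x. x)" by (rule prob_space_distr[OF f])
  have "distr M ?P (\<lambda>x. x) \<Otimes>\<^sub>M distr M ?F (\<lambda>x. x) = distr M (?P \<Otimes>\<^sub>M ?F) (\<lambda>x. (x, x))"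
  proof (rule pair_measure_eqI)
    fix A B assume "A \<in> sets (distr M ?P (\<lambda>x. x))" "B \<in> sets (distr M ?F (\<lambda>x. x))"
    then have A: "A \<in> sets ?P" and B: "B \<in> sets ?F" by auto
    have AM: "A \<in> events" "B \<in> events" using A B obs_sets sets_future_events by auto
    have [simp]: "(\<lambda>x. (x, x)) -` (A \<times> B) \<inter> space M = A \<inter> B"
      "(\<lambda>x. x) -` A \<inter> space M = A" "(\<lambda>x. x) -` B \<inter> space M = B"
      using sets.sets_into_space[OF AM(1)] sets.sets_into_space[OF AM(2)] by auto
    show "emeasure (distr M ?P (\<lambda>x. x)) A * emeasure (distr M ?F (\<lambda>x. x)) B =
        emeasure (distr M (?P \<Otimes>\<^sub>M ?F) (\<lambda>x. (x, x))) (A \<times> B)"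
      using A B p f indep_setD[OF indep_past_future A B]
      by (simp only: emeasure_distr sets_distr measurable_Pair pair_measureI emeasure_eq_measure
          ennreal_mult'' measure_nonneg
          \<open>(\<lambda>x. (x, x)) -` (A \<times> B) \<inter> space M = A \<inter> B\<close>
          \<open>(\<lambda>x. x) -` A \<inter> space M = A\<close> \<open>(\<lambda>x. x) -` B \<inter> space M = B\<close>)
  qed (simp_all add: P.sigma_finite_measure_axioms F.sigma_finite_measure_axioms)
  note eq = this
  have "(\<integral>\<^sup>+x. F (x, x) \<partial>M) = (\<integral>\<^sup>+z. F z \<partial>distr M (?P \<Otimes>\<^sub>M ?F) (\<lambda>x. (x, x)))"
    using p f F by (subst nn_integral_distr) auto
  also have "\<dots> = (\<integral>\<^sup>+x. \<integral>\<^sup>+y. F (x, y) \<partial>distr M ?F (\<lambda>x. x) \<partial>distr M ?P (\<lambda>x. x))"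
    unfolding eq[symmetric] using F by (subst F.nn_integral_fst) auto
  also have "\<dots> = (\<integral>\<^sup>+x. \<integral>\<^sup>+y. F (x, y) \<partial>distr M ?F (\<lambda>x. x) \<partial>M)"
    using p F by (subst nn_integral_distr) (auto intro!: F.borel_measurable_nn_integral)
  also have "\<dots> = (\<integral>\<^sup>+x. \<integral>\<^sup>+y. F (x, y) \<partial>M \<partial>M)"
  proof (rule nn_integral_cong)
    fix x assume "x \<in> space M"
    then have "(\<lambda>y. F (x, y)) \<in> borel_measurable ?F"
      using measurable_compose[OF measurable_Pair1' F] by simp
    then show "(\<integral>\<^sup>+y. F (x, y) \<partial>distr M ?F (\<lambda>x. x)) = (\<integral>\<^sup>+y. F (x, y) \<partial>M)"
      using f by (subst nn_integral_distr) auto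
  qed
  finally show ?thesis .
qed

lemma nn_integral_X:
  assumes "1 \<le> n" "f \<in> borel_measurable borel"
  shows "(\<integral>\<^sup>+x. f (X k n x) \<partial>M) = (\<integral>\<^sup>+y. ennreal (normal_density (\<theta> k n) 1 y) * f y \<partial>lborel)"
  using distributed_nn_integral[OF normal[OF assms(1)]] assms(2) by simp

lemma indep_vars_subfamily:
  assumes "inj_on f J" "f ` J \<subseteq> UNIV \<times> {1..}"
  shows "indep_vars (\<lambda>_. borel) (\<lambda>j. case f j of (k, n) \<Rightarrow> X k n) J"
proof -
  let ?E = "\<lambda>i. {(case i of (k, n) \<Rightarrow> X k n) -` A \<inter> space M |A. A \<in> sets borel}"
  have ind: "indep_sets ?E (UNIV \<times> {1..})"
    using indep unfolding indep_vars_def2 by blast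
  have "indep_sets (\<lambda>j. ?E (f j)) J"
  proof (rule indep_setsI)
    fix j assume "j \<in> J"
    then show "?E (f j) \<subseteq> events"
      using ind assms(2) unfolding indep_sets_def by blast
  next
    fix A L assume L: "L \<noteq> {}" "L \<subseteq> J" "finite L" "\<forall>j\<in>L. A j \<in> ?E (f j)"
    have inj: "inj_on f L" using assms(1) L(2) by (rule inj_on_subset)
    have g: "the_inv_into L f (f j) = j" if "j \<in> L" for j
      by (rule the_inv_into_f_f[OF inj that])
    have sub: "f ` L \<subseteq> UNIV \<times> {1..}" using L(2) assms(2) by blast
    have "prob (\<Inter>i\<in>f ` L. A (the_inv_into L f i)) = (\<Prod>i\<in>f ` L. prob (A (the_inv_into L f i)))"
      using L(1,3,4) g by (intro indep_setsD[OF ind sub]) auto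
    then show "prob (\<Inter> (A ` L)) = (\<Prod>j\<in>L. prob (A j))"
      using inj g by (simp add: prod.reindex image_image cong: INF_cong_simp)
  qed
  then show ?thesis
    using assms(2) X_measurable unfolding indep_vars_def2 by (auto split: prod.split)
qed

lemma indep_at_time: "1 \<le> n \<Longrightarrow> indep_vars (\<lambda>_. borel) (\<lambda>k. X k n) UNIV"
  using indep_vars_subfamily[of "\<lambda>k. (k, n)" UNIV] by (auto simp: inj_on_def)

lemma indep_in_stream: "1 \<le> m \<Longrightarrow> indep_vars (\<lambda>_. borel) (X k) {m..<l}"
  using indep_vars_subfamily[of "\<lambda>i. (k, i)" "{m..<l}"] by (auto simp: inj_on_def image_subset_iff)

end

section \<open>Likelihood ratios and the stopping rule\<close>

lemma measurable_count_space_enat: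
  fixes T :: "'a \<Rightarrow> enat"
  assumes "\<And>n. {x \<in> space M. T x \<le> enat n} \<in> sets M"
  shows "T \<in> measurable M (count_space UNIV)"
proof -
  have gt: "{x \<in> space M. T x = \<infinity>} \<in> sets M"
  proof -
    have "{x \<in> space M. T x = \<infinity>} = space M - (\<Union>n. {x \<in> space M. T x \<le> enat n})"
      by (auto, metis enat.exhaust order_refl)
    then show ?thesis using assms by auto
  qed
  have eq: "{x \<in> space M. T x = enat n} \<in> sets M" for n
  proof (cases n)
    case 0
    then have "{x \<in> space M. T x = enat n} = {x \<in> space M. T x \<le> enat n}" by (auto simp: enat_0)
    then show ?thesis using assms by auto
  next
    case (Suc m)
    then have "{x \<in> space M. T x = enat n} = {x \<in> space M. T x \<le> enat n} - {x \<in> space M. T x \<le> enat m}"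
      by (auto simp: not_le) (metis eSuc_enat order_antisym ileI1)
    then show ?thesis using assms by auto
  qed
  have "T -` {t} \<inter> space M \<in> sets M" for t
    using gt eq by (cases t) (auto simp: vimage_def Int_def conj_commute)
  then show ?thesis by (subst measurable_count_space_eq_countable) auto
qed

lemma stopping_time_sets:
  assumes "stopping_time (obs_filtration M X) T"
  shows "{x \<in> space M. T x \<le> enat n} \<in> sets (obs_filtration M X (enat n))"
    and "{x \<in> space M. enat n < T x} \<in> sets (obs_filtration M X (enat n))"
proof -
  have "Measurable.pred (obs_filtration M X (enat n)) (\<lambda>x. T x \<le> enat n)"
    using assms by (auto simp: stopping_time_def)
  then show *: "{x \<in> space M. T x \<le> enat n} \<in> sets (obs_filtration M X (enat n))"
    by (simp add: pred_def)
  have "{x \<in> space M. enat n < T x} = space (obs_filtration M X (enat n)) - {x \<in> space M. T x \<le> enat n}"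
    by auto
  with sets.compl_sets[OF *] show "{x \<in> space M. enat n < T x} \<in> sets (obs_filtration M X (enat n))" by (simp only:)
qed

lemma normal_density_ratio:
  "normal_density h 1 y / normal_density 0 1 y = exp (h * y - h\<^sup>2 / 2)"
  by (simp add: normal_density_def exp_diff[symmetric] power2_eq_square algebra_simps diff_divide_distrib add_divide_distrib)

lemma likelihood_ratio_exp:
  "likelihood_ratio \<omega> y n m =
     exp (\<Sum>l\<in>{m..n}. \<Sum>k\<in>UNIV. hard_estimate \<omega> y k m l * y k l - (hard_estimate \<omega> y k m l)\<^sup>2 / 2)"
  by (simp add: likelihood_ratio_def normal_density_ratio exp_sum)

lemma likelihood_ratio_pos: "0 < likelihood_ratio \<omega> y n m"
  by (simp add: likelihood_ratio_exp)

lemma likelihood_ratio_Suc: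
  "m \<le> Suc n \<Longrightarrow> likelihood_ratio \<omega> y (Suc n) m = likelihood_ratio \<omega> y n m *
     (\<Prod>k\<in>UNIV. normal_density (hard_estimate \<omega> y k m (Suc n)) 1 (y k (Suc n)) / normal_density 0 1 (y k (Suc n)))"
  by (simp add: likelihood_ratio_def)

lemma measurable_window_mean:
  assumes "\<And>i. m \<le> i \<Longrightarrow> i < l \<Longrightarrow> X k i \<in> borel_measurable G"
  shows "(\<lambda>x. window_mean (\<lambda>k i. X k i x) k m l) \<in> borel_measurable G"
  unfolding window_mean_def using assms by (intro borel_measurable_divide borel_measurable_sum) auto

lemma measurable_hard_estimate:
  assumes "\<And>i. m \<le> i \<Longrightarrow> i < l \<Longrightarrow> X k i \<in> borel_measurable G"
  shows "(\<lambda>x. hard_estimate \<omega> (\<lambda>k i. X k i x) k m l) \<in> borel_measurable G"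
proof -
  have [measurable]: "(\<lambda>x. window_mean (\<lambda>k i. X k i x) k m l) \<in> borel_measurable G"
    by (intro measurable_window_mean assms)
  show ?thesis unfolding hard_estimate_def by measurable
qed

lemma measurable_likelihood_ratio:
  assumes "\<And>k i. m \<le> i \<Longrightarrow> i \<le> n \<Longrightarrow> X k i \<in> borel_measurable G"
  shows "(\<lambda>x. likelihood_ratio \<omega> (\<lambda>k i. X k i x) n m) \<in> borel_measurable G"
  unfolding likelihood_ratio_exp
  by (intro borel_measurable_exp[THEN measurable_compose_rev] borel_measurable_sum borel_measurable_diff borel_measurable_times
      borel_measurable_divide borel_measurable_power measurable_hard_estimate assms borel_measurable_const) auto

lemma measurable_SR_statistic:
  assumes "\<And>k i. 1 \<le> i \<Longrightarrow> i \<le> n \<Longrightarrow> X k i \<in> borel_measurable G"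
  shows "(\<lambda>x. SR_statistic \<omega> (\<lambda>k i. X k i x) n) \<in> borel_measurable G"
  unfolding SR_statistic_def
  by (intro borel_measurable_sum measurable_likelihood_ratio assms) auto

text \<open>
  The scheme is still running after time \<open>n\<close> exactly if no statistic up to \<open>n\<close> has reached the threshold.
  All statements about the scheme go through this description of its tail events.
\<close>
lemma N_hard_gt_iff:
  "enat n < N_hard \<omega> X B x \<longleftrightarrow> (\<forall>i\<in>{1..n}. SR_statistic \<omega> (\<lambda>k i. X k i x) i < B)"
proof -
  have "N_hard \<omega> X B x \<le> enat n \<longleftrightarrow> (\<exists>i\<in>{1..n}. B \<le> SR_statistic \<omega> (\<lambda>k i. X k i x) i)"
  proof
    assume *: "N_hard \<omega> X B x \<le> enat n"
    show "\<exists>i\<in>{1..n}. B \<le> SR_statistic \<omega> (\<lambda>k i. X k i x) i"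
    proof (rule ccontr)
      assume "\<not> ?thesis"
      then have "enat (Suc n) \<le> N_hard \<omega> X B x"
        unfolding N_hard_def
        by (intro INF_greatest) (auto simp: not_less_eq_eq[symmetric] intro: ccontr)
      with * show False by (metis enat_ord_simps(1) not_less_eq_eq order.refl order_trans)
    qed
  next
    assume "\<exists>i\<in>{1..n}. B \<le> SR_statistic \<omega> (\<lambda>k i. X k i x) i"
    then obtain i where "1 \<le> i" "i \<le> n" "B \<le> SR_statistic \<omega> (\<lambda>k i. X k i x) i" by auto
    then show "N_hard \<omega> X B x \<le> enat n" unfolding N_hard_def
      by (intro INF_lower2[of i]) auto
  qed
  then show ?thesis by (meson not_le)
qed

lemma stopping_time_N_hard:
  fixes X :: "'k::finite \<Rightarrow> nat \<Rightarrow> 'a \<Rightarrow> real"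
  shows "stopping_time (obs_filtration M X) (N_hard \<omega> X B)"
  unfolding stopping_time_def
proof
  fix t
  show "Measurable.pred (obs_filtration M X t) (\<lambda>x. N_hard \<omega> X B x \<le> t)"
  proof (cases t)
    case (enat n)
    have [measurable]: "(\<lambda>x. SR_statistic \<omega> (\<lambda>k i. X k i x) i) \<in> borel_measurable (obs_filtration M X (enat n))"
      if "i \<in> {1..n}" for i
      using that by (intro measurable_SR_statistic measurable_obs_filtration) auto
    have "(N_hard \<omega> X B x \<le> t) = (\<exists>i\<in>{1..n}. B \<le> SR_statistic \<omega> (\<lambda>k i. X k i x) i)" for x
      using N_hard_gt_iff[of n \<omega> X B x] unfolding enat by (meson not_le)
    then show ?thesis unfolding enat by simp
  qed auto
qed

section \<open>The false alarm constraint\<close>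

context gaussian_streams
begin

lemma stopping_time_measurable:
  assumes "stopping_time (obs_filtration M X) T"
  shows "T \<in> measurable M (count_space UNIV)"
  by (rule measurable_count_space_enat) (rule obs_sets[OF stopping_time_sets(1)[OF assms]])

text \<open>
  Given the past, the estimates \<open>h k\<close> used at time \<open>n + 1\<close> are constants, and the density ratio of
  \<open>N(h, 1)\<close> to \<open>N(0, 1)\<close> integrates to 1 under \<open>N(0, 1)\<close> for every \<open>h\<close>. The case \<open>m = n + 1\<close> is
  included: then the empty product is 1 on the right, and on the left the estimates are 0.
\<close>
lemma likelihood_ratio_martingale:
  assumes \<theta>: "\<And>k n. \<theta> k n = 0"
    and G: "G \<in> sets (obs_filtration M X (enat n))" and m: "1 \<le> m" "m \<le> Suc n"
  shows "(\<integral>\<^sup>+x\<in>G. likelihood_ratio \<omega> (\<lambda>k i. X k i x) (Suc n) m \<partial>M) =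
         (\<integral>\<^sup>+x\<in>G. likelihood_ratio \<omega> (\<lambda>k i. X k i x) n m \<partial>M)"
proof -
  let ?h = "\<lambda>x k. hard_estimate \<omega> (\<lambda>k i. X k i x) k m (Suc n)"
  let ?L = "\<lambda>x. ennreal (likelihood_ratio \<omega> (\<lambda>k i. X k i x) n m) * indicator G x"
  let ?r = "\<lambda>h y. ennreal (normal_density h 1 y / normal_density 0 1 y)"
  have Lm [measurable]: "?L \<in> borel_measurable (obs_filtration M X (enat n))"
    using G m by (intro borel_measurable_times_ennreal measurable_compose[OF _ measurable_ennreal] borel_measurable_indicator
        measurable_likelihood_ratio measurable_obs_filtration) auto
  have hm [measurable]: "(\<lambda>x. ?h x k) \<in> borel_measurable (obs_filtration M X (enat n))" for k
    using m by (intro measurable_hard_estimate measurable_obs_filtration) auto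
  have Xm [measurable]: "X k (Suc n) \<in> borel_measurable (future n)" for k
    by (rule measurable_future) simp
  have rm [measurable]: "?r h \<in> borel_measurable borel" for h by measurable
  have one: "(\<integral>\<^sup>+y. (\<Prod>k\<in>UNIV. ?r (h k) (X k (Suc n) y)) \<partial>M) = 1" for h
  proof -
    have "indep_vars (\<lambda>_. borel) (\<lambda>k y. ?r (h k) (X k (Suc n) y)) UNIV"
      by (rule indep_vars_compose2[OF indep_at_time]) auto
    then have "(\<integral>\<^sup>+y. (\<Prod>k\<in>UNIV. ?r (h k) (X k (Suc n) y)) \<partial>M) =
        (\<Prod>k\<in>UNIV. \<integral>\<^sup>+y. ?r (h k) (X k (Suc n) y) \<partial>M)"
      by (intro indep_vars_nn_integral) auto
    also have "\<dots> = (\<Prod>k\<in>(UNIV :: 'k set). 1)"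
    proof (rule prod.cong[OF refl])
      fix k
      have "(\<integral>\<^sup>+y. ?r (h k) (X k (Suc n) y) \<partial>M) =
          (\<integral>\<^sup>+y. ennreal (normal_density 0 1 y) * ?r (h k) y \<partial>lborel)"
        using nn_integral_X[of "Suc n" "?r (h k)" k] \<theta> by simp
      also have "\<dots> = (\<integral>\<^sup>+y. ennreal (normal_density (h k) 1 y) \<partial>lborel)"
        using normal_density_pos[of 1 0] by (intro nn_integral_cong) (auto simp: ennreal_mult'[symmetric] less_imp_neq[symmetric])
      also have "\<dots> = ennreal (\<integral>y. normal_density (h k) 1 y \<partial>lborel)"
        by (intro nn_integral_eq_integral) auto
      finally show "(\<integral>\<^sup>+y. ?r (h k) (X k (Suc n) y) \<partial>M) = 1" by simp
    qed
    finally show ?thesis by simp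
  qed
  let ?F = "\<lambda>(x, y). ?L x * (\<Prod>k\<in>UNIV. ?r (?h x k) (X k (Suc n) y))"
  have Fm: "?F \<in> borel_measurable (obs_filtration M X (enat n) \<Otimes>\<^sub>M future n)"
    unfolding normal_density_ratio by measurable
  have "(\<integral>\<^sup>+x\<in>G. likelihood_ratio \<omega> (\<lambda>k i. X k i x) (Suc n) m \<partial>M) = (\<integral>\<^sup>+x. ?F (x, x) \<partial>M)"
    using m likelihood_ratio_pos[of \<omega> _ n m]
    by (intro nn_integral_cong) (simp add: likelihood_ratio_Suc ennreal_mult'[OF less_imp_le] prod_ennreal[symmetric] mult_ac less_imp_le)
  also have "\<dots> = (\<integral>\<^sup>+x. \<integral>\<^sup>+y. ?F (x, y) \<partial>M \<partial>M)"
    by (rule nn_integral_past_future[OF Fm])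
  also have "\<dots> = (\<integral>\<^sup>+x. ?L x \<partial>M)"
  proof (rule nn_integral_cong)
    fix x
    have [measurable]: "X k (Suc n) \<in> borel_measurable M" for k by (rule X_measurable) simp
    show "(\<integral>\<^sup>+y. ?F (x, y) \<partial>M) = ?L x"
      by (simp add: nn_integral_cmult one)
  qed
  finally show ?thesis .
qed

text \<open>
  Each old summand is a martingale, and the new summand, which starts at 1, contributes the mass of \<open>G\<close>.
\<close>
lemma SR_statistic_drift:
  assumes \<theta>: "\<And>k n. \<theta> k n = 0" and G: "G \<in> sets (obs_filtration M X (enat n))"
  shows "(\<integral>\<^sup>+x\<in>G. SR_statistic \<omega> (\<lambda>k i. X k i x) (Suc n) \<partial>M) =
         (\<integral>\<^sup>+x\<in>G. SR_statistic \<omega> (\<lambda>k i. X k i x) n \<partial>M) + emeasure M G"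
proof -
  let ?L = "\<lambda>n m x. likelihood_ratio \<omega> (\<lambda>k i. X k i x) n m"
  have GM [measurable]: "G \<in> sets M" using obs_sets[OF G] .
  have Lm [measurable]: "?L n' m \<in> borel_measurable M" if "1 \<le> m" for n' m
    using that by (intro measurable_likelihood_ratio X_measurable) auto
  have S: "(\<integral>\<^sup>+x\<in>G. (\<Sum>m\<in>{1..j}. ?L n' m x) \<partial>M) = (\<Sum>m\<in>{1..j}. \<integral>\<^sup>+x\<in>G. ?L n' m x \<partial>M)" for n' j
  proof -
    have "ennreal (\<Sum>m\<in>{1..j}. ?L n' m x) * indicator G x = (\<Sum>m\<in>{1..j}. ennreal (?L n' m x) * indicator G x)" for x
      unfolding sum_distrib_right[symmetric] by (subst sum_ennreal) (auto intro: less_imp_le likelihood_ratio_pos)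
    then show ?thesis by (simp only:) (rule nn_integral_sum, auto)
  qed
  have "(\<integral>\<^sup>+x\<in>G. SR_statistic \<omega> (\<lambda>k i. X k i x) (Suc n) \<partial>M) = (\<Sum>m\<in>{1..Suc n}. \<integral>\<^sup>+x\<in>G. ?L n m x \<partial>M)"
    unfolding SR_statistic_def S
    by (rule sum.cong[OF refl], rule likelihood_ratio_martingale[OF \<theta> G]) auto
  also have "\<dots> = (\<Sum>m\<in>{1..n}. \<integral>\<^sup>+x\<in>G. ?L n m x \<partial>M) + (\<integral>\<^sup>+x\<in>G. ?L n (Suc n) x \<partial>M)"
    by simp
  also have "(\<integral>\<^sup>+x\<in>G. ?L n (Suc n) x \<partial>M) = emeasure M G"
    unfolding likelihood_ratio_def by simp
  finally show ?thesis unfolding SR_statistic_def S .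
qed

text \<open>
  This is optional stopping for the martingale \<open>R\<^sub>n - n\<close> at the minimum of \<open>N\<close> and \<open>n\<close>: as \<open>R\<close> is at
  least \<open>A\<close> when \<open>N\<close> stops, the expected time up to \<open>n\<close> is at least \<open>A\<close> times the probability of having
  stopped. If that probability does not tend to 1, then \<open>N\<close> has infinite mean and there is nothing to prove.
\<close>
theorem N_hard_false_alarm:
  assumes \<theta>: "\<And>k n. \<theta> k n = 0" and "0 < A"
  shows "ennreal A \<le> (\<integral>\<^sup>+x. ennreal_of_enat (N_hard \<omega> X A x) \<partial>M)"
proof -
  let ?R = "\<lambda>n x. SR_statistic \<omega> (\<lambda>k i. X k i x) n"
  define G where "G n = {x \<in> space M. enat n < N_hard \<omega> X A x}" for n
  have Gs: "G n \<in> sets (obs_filtration M X (enat n))" for n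
    unfolding G_def by (rule stopping_time_sets(2)[OF stopping_time_N_hard])
  have Gm [measurable]: "G n \<in> sets M" for n by (rule obs_sets[OF Gs])
  have Gdec: "G (Suc n) \<subseteq> G n" for n unfolding G_def N_hard_gt_iff by auto
  have Rm [measurable]: "?R n \<in> borel_measurable M" for n
    by (intro measurable_SR_statistic X_measurable) auto
  have exit: "A \<le> ?R (Suc n) x" if "x \<in> G n - G (Suc n)" for n x
    using that unfolding G_def N_hard_gt_iff by (auto simp: atLeastAtMostSuc_conv not_less)
  have main: "(\<integral>\<^sup>+x\<in>G n. ?R n x \<partial>M) + ennreal A * emeasure M (space M - G n) \<le> (\<Sum>j<n. emeasure M (G j))" for n
  proof (induction n)
    case 0
    have "G 0 = space M" unfolding G_def N_hard_gt_iff by auto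
    then show ?case by (simp add: SR_statistic_def)
  next
    case (Suc n)
    have "(\<integral>\<^sup>+x\<in>G (Suc n). ?R (Suc n) x \<partial>M) + ennreal A * emeasure M (G n - G (Suc n)) =
       (\<integral>\<^sup>+x\<in>G (Suc n). ?R (Suc n) x \<partial>M) + (\<integral>\<^sup>+x. ennreal A * indicator (G n - G (Suc n)) x \<partial>M)"
      by (subst nn_integral_cmult_indicator) auto
    also have "\<dots> = (\<integral>\<^sup>+x. ennreal (?R (Suc n) x) * indicator (G (Suc n)) x + ennreal A * indicator (G n - G (Suc n)) x \<partial>M)"
      by (rule nn_integral_add[symmetric]) auto
    also have "\<dots> \<le> (\<integral>\<^sup>+x\<in>G n. ?R (Suc n) x \<partial>M)"
      using exit[of _ n] Gdec[of n] by (intro nn_integral_mono) (auto split: split_indicator intro: ennreal_leI)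
    also have "\<dots> = (\<integral>\<^sup>+x\<in>G n. ?R n x \<partial>M) + emeasure M (G n)"
      by (rule SR_statistic_drift[OF \<theta> Gs])
    finally have 1: "(\<integral>\<^sup>+x\<in>G (Suc n). ?R (Suc n) x \<partial>M) + ennreal A * emeasure M (G n - G (Suc n))
       \<le> (\<integral>\<^sup>+x\<in>G n. ?R n x \<partial>M) + emeasure M (G n)" .
    have "space M - G (Suc n) = (G n - G (Suc n)) \<union> (space M - G n)"
      using Gdec[of n] sets.sets_into_space[OF Gm[of n]] by auto
    then have "emeasure M (space M - G (Suc n)) = emeasure M (G n - G (Suc n)) + emeasure M (space M - G n)"
      by (subst plus_emeasure) auto
    then have "(\<integral>\<^sup>+x\<in>G (Suc n). ?R (Suc n) x \<partial>M) + ennreal A * emeasure M (space M - G (Suc n)) =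
      ((\<integral>\<^sup>+x\<in>G (Suc n). ?R (Suc n) x \<partial>M) + ennreal A * emeasure M (G n - G (Suc n))) + ennreal A * emeasure M (space M - G n)"
      by (simp add: distrib_left add.assoc)
    also have "\<dots> \<le> ((\<integral>\<^sup>+x\<in>G n. ?R n x \<partial>M) + emeasure M (G n)) + ennreal A * emeasure M (space M - G n)"
      by (intro add_right_mono 1)
    also have "\<dots> = ((\<integral>\<^sup>+x\<in>G n. ?R n x \<partial>M) + ennreal A * emeasure M (space M - G n)) + emeasure M (G n)"
      by (simp add: ac_simps)
    also have "\<dots> \<le> (\<Sum>j<n. emeasure M (G j)) + emeasure M (G n)"
      by (intro add_right_mono Suc.IH)
    finally show ?case by simp
  qed
  have E: "(\<integral>\<^sup>+x. ennreal_of_enat (N_hard \<omega> X A x) \<partial>M) = (\<Sum>n. emeasure M (G n))"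
    unfolding G_def by (rule nn_integral_enat_function[OF stopping_time_measurable[OF stopping_time_N_hard]])
  show ?thesis
  proof (cases "(\<Sum>n. emeasure M (G n)) = \<infinity>")
    case True then show ?thesis unfolding E by simp
  next
    case False
    then have "(\<lambda>n. prob (G n)) \<longlonglongrightarrow> 0"
      by (intro summable_LIMSEQ_zero summable_suminf_not_top) (auto simp: emeasure_eq_measure)
    then have "(\<lambda>n. A * (1 - prob (G n))) \<longlonglongrightarrow> A * (1 - 0)" by (intro tendsto_intros)
    then have lim: "(\<lambda>n. ennreal (A * (1 - prob (G n)))) \<longlonglongrightarrow> ennreal A" by (intro tendsto_ennrealI) simp
    have "ennreal (A * (1 - prob (G n))) \<le> (\<Sum>n. emeasure M (G n))" for n
    proof -
      have "ennreal (A * (1 - prob (G n))) = ennreal A * emeasure M (space M - G n)"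
        using \<open>0 < A\<close> by (simp add: emeasure_eq_measure prob_compl ennreal_mult')
      also have "\<dots> \<le> (\<integral>\<^sup>+x\<in>G n. ?R n x \<partial>M) + ennreal A * emeasure M (space M - G n)" by simp
      also have "\<dots> \<le> (\<Sum>j<n. emeasure M (G j))" by (rule main)
      also have "\<dots> \<le> (\<Sum>n. emeasure M (G n))" by (rule sum_le_suminf) auto
      finally show ?thesis .
    qed
    then show ?thesis unfolding E by (intro LIMSEQ_le_const2[OF lim]) auto
  qed
qed

end

section \<open>Essential suprema of conditional expectations\<close>

lemma (in finite_measure_subalgebra) nn_integral_le_esssup_cond_exp:
  assumes "prob_space M" and [measurable]: "f \<in> borel_measurable M"
  shows "(\<integral>\<^sup>+x. f x \<partial>M) \<le> esssup M (nn_cond_exp M F f)"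
proof -
  interpret P: prob_space M by fact
  have "(\<integral>\<^sup>+x. f x \<partial>M) = (\<integral>\<^sup>+x. nn_cond_exp M F f x \<partial>M)"
    using nn_cond_exp_intg[of "\<lambda>_. 1" f] by simp
  also have "\<dots> \<le> (\<integral>\<^sup>+x. esssup M (nn_cond_exp M F f) \<partial>M)"
    by (rule nn_integral_mono_AE[OF esssup_AE])
  also have "\<dots> = esssup M (nn_cond_exp M F f)" by (simp add: P.emeasure_space_1)
  finally show ?thesis .
qed

text \<open>
  The hypothesis is tested on the event where the conditional expectation exceeds \<open>c\<close>; finiteness of
  \<open>c\<close> allows the excess over \<open>c\<close> to be split off there.
\<close>
lemma (in finite_measure_subalgebra) esssup_cond_exp_le:
  assumes f [measurable]: "f \<in> borel_measurable M" and c: "c \<noteq> \<infinity>"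
    and le: "\<And>B. B \<in> sets F \<Longrightarrow> (\<integral>\<^sup>+x\<in>B. f x \<partial>M) \<le> c * emeasure M B"
  shows "esssup M (nn_cond_exp M F f) \<le> c"
proof (rule esssup_I)
  define B where "B = {x \<in> space F. c < nn_cond_exp M F f x}"
  have B: "B \<in> sets F" unfolding B_def by measurable
  then have [measurable]: "B \<in> sets M" using subalg by (auto simp: subalgebra_def)
  let ?d = "\<lambda>x. (nn_cond_exp M F f x - c) * indicator B x"
  have "(\<integral>\<^sup>+x. ?d x \<partial>M) + c * emeasure M B = (\<integral>\<^sup>+x. ?d x + c * indicator B x \<partial>M)"
    by (subst nn_integral_add) (auto simp: nn_integral_cmult_indicator)
  also have "\<dots> = (\<integral>\<^sup>+x. indicator B x * nn_cond_exp M F f x \<partial>M)"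
    by (rule nn_integral_cong) (auto simp: B_def split: split_indicator intro!: diff_add_cancel_ennreal)
  also have "\<dots> = (\<integral>\<^sup>+x. indicator B x * f x \<partial>M)"
    using B by (intro nn_cond_exp_intg) auto
  also have "\<dots> \<le> c * emeasure M B"
    using le[OF B] by (simp add: mult.commute)
  finally have "c * emeasure M B + (\<integral>\<^sup>+x. ?d x \<partial>M) \<le> c * emeasure M B + 0"
    by (simp add: add.commute)
  moreover have "c * emeasure M B \<noteq> \<infinity>"
    using c by (simp add: ennreal_mult_eq_top_iff emeasure_eq_measure)
  ultimately have "(\<integral>\<^sup>+x. ?d x \<partial>M) = 0"
    unfolding ennreal_add_left_cancel_le by simp
  then have "AE x in M. ?d x = 0" by (subst (asm) nn_integral_0_iff_AE) auto
  then show "AE x in M. nn_cond_exp M F f x \<le> c"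
  proof (rule AE_mp, intro AE_I2 impI)
    fix x assume "x \<in> space M" "?d x = 0"
    then show "nn_cond_exp M F f x \<le> c"
      using c subalg
      by (cases "c < nn_cond_exp M F f x") (auto simp: B_def subalgebra_def not_less ennreal_minus_eq_0)
  qed
qed auto

section \<open>Change of measure\<close>

lemma (in gaussian_streams) nn_integral_prod_X:
  assumes J: "finite J" "J \<subseteq> UNIV \<times> {1..}"
    and g [measurable]: "\<And>p. p \<in> J \<Longrightarrow> g p \<in> borel_measurable borel"
  shows "(\<integral>\<^sup>+x. (\<Prod>p\<in>J. g p (X (fst p) (snd p) x)) \<partial>M) =
         (\<Prod>p\<in>J. \<integral>\<^sup>+y. ennreal (normal_density (\<theta> (fst p) (snd p)) 1 y) * g p y \<partial>lborel)"
proof -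
  have "indep_vars (\<lambda>_. borel) (\<lambda>p x. g p ((case p of (k, n) \<Rightarrow> X k n) x)) J"
    by (rule indep_vars_compose2[OF indep_vars_subset[OF indep J(2)] g])
  then have "(\<integral>\<^sup>+x. (\<Prod>p\<in>J. g p (X (fst p) (snd p) x)) \<partial>M) = (\<Prod>p\<in>J. \<integral>\<^sup>+x. g p (X (fst p) (snd p) x) \<partial>M)"
    using J(1) by (intro indep_vars_nn_integral) (auto simp: case_prod_unfold)
  also have "\<dots> = (\<Prod>p\<in>J. \<integral>\<^sup>+y. ennreal (normal_density (\<theta> (fst p) (snd p)) 1 y) * g p y \<partial>lborel)"
    using J by (intro prod.cong refl nn_integral_X) auto
  finally show ?thesis .
qed

text \<open>
  Two laws of the streams that live on the same measurable space are determined up to time \<open>n\<close> by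
  their values on rectangles, and on a rectangle both sides are products over the finitely many
  observations involved.
\<close>
lemma change_of_measure:
  fixes X :: "'k::finite \<Rightarrow> nat \<Rightarrow> 'a \<Rightarrow> real"
  assumes M: "gaussian_streams M X \<theta>" and N: "gaussian_streams N X \<theta>'" and sets: "sets N = sets M"
    and E: "E \<in> sets (obs_filtration M X (enat n))"
  shows "emeasure N E = (\<integral>\<^sup>+x\<in>E. ennreal (\<Prod>p\<in>UNIV \<times> {1..n}.
      normal_density (\<theta>' (fst p) (snd p)) 1 (X (fst p) (snd p) x) /
      normal_density (\<theta> (fst p) (snd p)) 1 (X (fst p) (snd p) x)) \<partial>M)"
proof -
  interpret M: gaussian_streams M X \<theta> by fact
  interpret N: gaussian_streams N X \<theta>' by fact
  let ?J = "(UNIV :: 'k set) \<times> {1..n}"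
  have J: "finite ?J" "?J \<subseteq> UNIV \<times> {1..}" by auto
  define r where "r p y = normal_density (\<theta>' (fst p) (snd p)) 1 y / normal_density (\<theta> (fst p) (snd p)) 1 y" for p y
  have r: "0 \<le> r p y" for p y by (simp add: r_def)
  have rm [measurable]: "r p \<in> borel_measurable borel" for p unfolding r_def by measurable
  define L where "L x = ennreal (\<Prod>p\<in>?J. r p (X (fst p) (snd p) x))" for x
  have Xm [measurable]: "X (fst p) (snd p) \<in> borel_measurable M" if "p \<in> ?J" for p
    using that by (intro M.X_measurable) auto
  have Lm [measurable]: "L \<in> borel_measurable M" unfolding L_def by measurable
  define rect where "rect B = {x \<in> space M. \<forall>p\<in>?J. X (fst p) (snd p) x \<in> B p}" for B :: "'k \<times> nat \<Rightarrow> real set"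
  define C where "C = {rect B | B. \<forall>p\<in>?J. B p \<in> sets borel}"
  let ?F = "obs_filtration M X (enat n)"
  have sp: "space N = space M" using sets by (rule sets_eq_imp_space_eq)
  have F_sub: "?F = obs_filtration N X (enat n)" using sp by (intro obs_filtration_cong) simp
  have rectM: "rect B \<in> sets ?F" if "\<forall>p\<in>?J. B p \<in> sets borel" for B
  proof -
    have "{x \<in> space ?F. X (fst p) (snd p) x \<in> B p} \<in> sets ?F" if "p \<in> ?J" for p
      using measurable_sets[OF measurable_obs_filtration[of "snd p" "enat n" X "fst p" M], of "B p"] that
        \<open>\<forall>p\<in>?J. B p \<in> sets borel\<close> by (auto simp: vimage_def Int_def conj_commute)
    then have "{x \<in> space ?F. \<forall>p\<in>?J. X (fst p) (snd p) x \<in> B p} \<in> sets ?F"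
      by (intro sets.sets_Collect_finite_All) auto
    then show ?thesis unfolding rect_def by simp
  qed
  have gen: "sets ?F = sigma_sets (space M) C"
  proof (rule antisym)
    show "sigma_sets (space M) C \<subseteq> sets ?F"
      using sets.sigma_sets_subset[of C ?F] rectM unfolding C_def by auto
    show "sets ?F \<subseteq> sigma_sets (space M) C"
      unfolding sets_obs_filtration
    proof (rule sigma_sets_mono, safe)
      fix k i and B :: "real set" assume *: "1 \<le> i" "enat i \<le> enat n" "B \<in> sets borel"
      have "X k i -` B \<inter> space M = rect (\<lambda>p. if p = (k, i) then B else UNIV)"
        using * unfolding rect_def by (auto split: if_splits)
      then show "X k i -` B \<inter> space M \<in> sigma_sets (space M) C"
        using * unfolding C_def by (intro sigma_sets.Basic) auto
    qed
  qed
  have "restr_to_subalg N ?F = restr_to_subalg (density M L) ?F"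
  proof (rule measure_eqI_generator_eq)
    have sN: "subalgebra N ?F" using N.subalgebra_obs F_sub by simp
    have sM: "subalgebra (density M L) ?F" using M.subalgebra_obs by (simp add: subalgebra_def)
    show "Int_stable C"
    proof (rule Int_stableI)
      fix a b assume "a \<in> C" "b \<in> C"
      then obtain A B where "a = rect A" "b = rect B" "\<forall>p\<in>?J. A p \<in> sets borel" "\<forall>p\<in>?J. B p \<in> sets borel"
        unfolding C_def by auto
      then show "a \<inter> b \<in> C"
        unfolding C_def by (intro CollectI exI[of _ "\<lambda>p. A p \<inter> B p"]) (auto simp: rect_def)
    qed
    show "C \<subseteq> Pow (space M)" unfolding C_def rect_def by auto
    show "sets (restr_to_subalg N ?F) = sigma_sets (space M) C"
      by (simp add: sets_restr_to_subalg[OF sN] gen)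
    show "sets (restr_to_subalg (density M L) ?F) = sigma_sets (space M) C"
      by (simp add: sets_restr_to_subalg[OF sM] gen)
    have spC: "space M \<in> C"
      unfolding C_def rect_def by (intro CollectI exI[of _ "\<lambda>_. UNIV"]) auto
    show "range (\<lambda>_::nat. space M) \<subseteq> C" "(\<Union>i::nat. space M) = space M" using spC by auto
    have "emeasure (restr_to_subalg N ?F) (space N) = 1"
      using sp sets.top[of ?F] N.emeasure_space_1 by (subst emeasure_restr_to_subalg[OF sN]) auto
    then show "emeasure (restr_to_subalg N ?F) (space M) \<noteq> \<infinity>" for i :: nat using sp by simp
    fix S assume "S \<in> C"
    then obtain B where S: "S = rect B" and B [measurable]: "\<And>p. p \<in> ?J \<Longrightarrow> B p \<in> sets borel"
      unfolding C_def by auto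
    have SF: "S \<in> sets ?F" unfolding S using B by (intro rectM) auto
    have SM [measurable]: "S \<in> sets M" "S \<in> sets N" using M.obs_sets[OF SF] sets by auto
    \<comment> \<open>The indicator of a rectangle is a product, so independence applies to it.\<close>
    have ind: "indicator S x = (\<Prod>p\<in>?J. indicator (B p) (X (fst p) (snd p) x) :: ennreal)" if "x \<in> space M" for x
    proof (cases "x \<in> S")
      case True
      then have "\<forall>p\<in>?J. X (fst p) (snd p) x \<in> B p" unfolding S rect_def by simp
      then have "(\<Prod>p\<in>?J. indicator (B p) (X (fst p) (snd p) x) :: ennreal) = 1"
        by (intro prod.neutral) auto
      with True show ?thesis by simp
    next
      case False
      then have "\<not> (\<forall>p\<in>?J. X (fst p) (snd p) x \<in> B p)"
        using that unfolding S rect_def mem_Collect_eq by metis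
      then obtain p where p: "p \<in> ?J" "X (fst p) (snd p) x \<notin> B p" unfolding Ball_def by metis
      have "indicator (B p) (X (fst p) (snd p) x) = (0 :: ennreal)" using p(2) by simp
      with J(1) p(1) have "(\<Prod>p\<in>?J. indicator (B p) (X (fst p) (snd p) x) :: ennreal) = 0"
        by (metis (mono_tags, lifting) prod_zero)
      with False show ?thesis by simp
    qed
    have "emeasure N S = (\<integral>\<^sup>+x. indicator S x \<partial>N)" by simp
    also have "\<dots> = (\<integral>\<^sup>+x. (\<Prod>p\<in>?J. indicator (B p) (X (fst p) (snd p) x)) \<partial>N)"
      using ind sp by (intro nn_integral_cong) auto
    also have "\<dots> = (\<Prod>p\<in>?J. \<integral>\<^sup>+y. ennreal (normal_density (\<theta>' (fst p) (snd p)) 1 y) * indicator (B p) y \<partial>lborel)"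
      using J B by (intro N.nn_integral_prod_X) auto
    also have "\<dots> = (\<Prod>p\<in>?J. \<integral>\<^sup>+y. ennreal (normal_density (\<theta> (fst p) (snd p)) 1 y) *
           (ennreal (r p y) * indicator (B p) y) \<partial>lborel)"
    proof (intro prod.cong refl nn_integral_cong)
      fix p and y :: real
      show "ennreal (normal_density (\<theta>' (fst p) (snd p)) 1 y) * indicator (B p) y =
        ennreal (normal_density (\<theta> (fst p) (snd p)) 1 y) * (ennreal (r p y) * indicator (B p) y)"
        using normal_density_pos[of 1 "\<theta> (fst p) (snd p)" y]
        by (simp add: mult.assoc[symmetric] ennreal_mult'[symmetric] r_def)
    qed
    also have "\<dots> = (\<integral>\<^sup>+x. (\<Prod>p\<in>?J. ennreal (r p (X (fst p) (snd p) x)) * indicator (B p) (X (fst p) (snd p) x)) \<partial>M)"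
      using J B by (intro M.nn_integral_prod_X[symmetric]) auto
    also have "\<dots> = (\<integral>\<^sup>+x. L x * indicator S x \<partial>M)"
      using ind r by (intro nn_integral_cong) (simp add: prod.distrib L_def prod_ennreal)
    also have "\<dots> = emeasure (density M L) S" by (simp add: emeasure_density)
    finally show "emeasure (restr_to_subalg N ?F) S = emeasure (restr_to_subalg (density M L) ?F) S"
      by (simp add: emeasure_restr_to_subalg[OF sN SF] emeasure_restr_to_subalg[OF sM SF])
  qed
  then have "emeasure (restr_to_subalg N ?F) E = emeasure (restr_to_subalg (density M L) ?F) E" by simp
  moreover have "subalgebra N ?F" using N.subalgebra_obs F_sub by simp
  moreover have "subalgebra (density M L) ?F" using M.subalgebra_obs by (simp add: subalgebra_def)
  ultimately have "emeasure N E = emeasure (density M L) E"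
    using emeasure_restr_to_subalg E by metis
  then show ?thesis using M.obs_sets[OF E] by (simp add: emeasure_density L_def r_def)
qed

context change_point_model
begin

lemma gaussian_Pinf: "gaussian_streams Pinf X (\<lambda>k n. 0)"
  using prob_space_Pinf indep_Pinf normal_Pinf
  by (auto simp: gaussian_streams_def gaussian_streams_axioms_def)

lemma gaussian_P: "1 \<le> \<nu> \<Longrightarrow> gaussian_streams (P \<mu> \<nu>) X (\<lambda>k n. if n < \<nu> then 0 else \<mu> $ k)"
  using prob_space_P indep_P normal_P_before normal_P_after
  by (auto simp: gaussian_streams_def gaussian_streams_axioms_def)

lemma space_P: "1 \<le> \<nu> \<Longrightarrow> space (P \<mu> \<nu>) = space Pinf"
  by (rule sets_eq_imp_space_eq) (rule sets_P)

text \<open>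
  The logarithm of the likelihood ratio, based on the observations up to \<open>n\<close>, of a change to \<open>\<mu>\<close> at time
  \<open>\<nu>\<close> against no change.
\<close>
definition log_lr :: "real ^ 'k \<Rightarrow> nat \<Rightarrow> nat \<Rightarrow> 'a \<Rightarrow> real" where
  "log_lr \<mu> \<nu> n x = (\<Sum>i\<in>{\<nu>..n}. \<Sum>k\<in>UNIV. \<mu> $ k * X k i x - (\<mu> $ k)\<^sup>2 / 2)"

lemma measurable_log_lr: "1 \<le> \<nu> \<Longrightarrow> log_lr \<mu> \<nu> n \<in> borel_measurable Pinf"
  unfolding log_lr_def using gaussian_streams.X_measurable[OF gaussian_Pinf]
  by (intro borel_measurable_sum borel_measurable_diff borel_measurable_times) auto

lemma P_eq_nn_integral:
  assumes \<nu>: "1 \<le> \<nu>" and E: "E \<in> sets (obs_filtration Pinf X (enat n))"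
  shows "emeasure (P \<mu> \<nu>) E = (\<integral>\<^sup>+x\<in>E. ennreal (exp (log_lr \<mu> \<nu> n x)) \<partial>Pinf)"
proof -
  have "(\<Prod>p\<in>UNIV \<times> {1..n}.
      normal_density (if snd p < \<nu> then 0 else \<mu> $ fst p) 1 (X (fst p) (snd p) x) /
      normal_density 0 1 (X (fst p) (snd p) x)) = exp (log_lr \<mu> \<nu> n x)" for x
  proof -
    have "(\<Prod>p\<in>UNIV \<times> {1..n}.
      normal_density (if snd p < \<nu> then 0 else \<mu> $ fst p) 1 (X (fst p) (snd p) x) /
      normal_density 0 1 (X (fst p) (snd p) x)) =
      (\<Prod>p\<in>UNIV \<times> {\<nu>..n}. exp (\<mu> $ fst p * X (fst p) (snd p) x - (\<mu> $ fst p)\<^sup>2 / 2))"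
      using \<nu> by (intro prod.mono_neutral_cong_right) (auto simp: normal_density_ratio)
    also have "\<dots> = exp (\<Sum>p\<in>UNIV \<times> {\<nu>..n}. \<mu> $ fst p * X (fst p) (snd p) x - (\<mu> $ fst p)\<^sup>2 / 2)"
      by (simp add: exp_sum)
    also have "(\<Sum>p\<in>UNIV \<times> {\<nu>..n}. \<mu> $ fst p * X (fst p) (snd p) x - (\<mu> $ fst p)\<^sup>2 / 2) = log_lr \<mu> \<nu> n x"
      unfolding log_lr_def by (subst sum.swap) (simp add: sum.cartesian_product case_prod_unfold)
    finally show ?thesis .
  qed
  then show ?thesis
    using change_of_measure[OF gaussian_Pinf gaussian_P[OF \<nu>] sets_P[OF \<nu>] E, of \<mu>] by simp
qed

lemma P_eq_Pinf_before_change: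
  assumes "1 \<le> \<nu>" and "n < \<nu>" and "E \<in> sets (obs_filtration Pinf X (enat n))"
  shows "emeasure (P \<mu> \<nu>) E = emeasure Pinf E"
  using P_eq_nn_integral[OF assms(1,3), of \<mu>] assms(2)
    gaussian_streams.obs_sets[OF gaussian_Pinf assms(3)] by (simp add: log_lr_def)

end

section \<open>Lower bound for the delay of every stopping time\<close>

text \<open>
  The relative entropy of one post-change observation vector with respect to a pre-change one.
\<close>
definition information :: "real ^ 'k::finite \<Rightarrow> real" where
  "information \<mu> = (\<Sum>k\<in>UNIV. (\<mu> $ k)\<^sup>2) / 2"

text \<open>
  Here \<open>p j\<close> is the probability of \<open>T > j\<close>. If the hazard of stopping within \<open>m\<close> steps were larger at all
  times, summing over \<open>j\<close> would give a contradiction: the differences telescope to at most \<open>m\<close>, while the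
  right-hand sides add up to at least \<open>2 m\<close>.
\<close>
lemma exists_low_hazard_time:
  fixes p :: "nat \<Rightarrow> real"
  assumes p: "\<And>j. 0 \<le> p j" "\<And>j. p j \<le> 1" "\<And>i j. i \<le> j \<Longrightarrow> p j \<le> p i"
    and A: "0 < A" and m: "0 < m" and sum: "ennreal A \<le> (\<Sum>j. ennreal (p j))"
  shows "\<exists>j. 0 < p j \<and> p j - p (j + m) \<le> 2 * real m / A * p j"
proof (rule ccontr)
  assume neg: "\<not> ?thesis"
  have *: "2 * real m / A * p j \<le> p j - p (j + m)" for j
  proof (cases "p j = 0")
    case True
    then show ?thesis using p(3)[of j "j + m"] by simp
  next
    case False
    then have "0 < p j" using p(1)[of j] by simp
    then show ?thesis using neg by (meson less_imp_le not_le)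
  qed
  have "(\<Sum>j<n. p j) \<le> A / 2" for n
  proof -
    have "2 * real m / A * (\<Sum>j<n. p j) \<le> (\<Sum>j<n. p j - p (j + m))"
      unfolding sum_distrib_left by (intro sum_mono *)
    also have "\<dots> = (\<Sum>j<n. p j) - (\<Sum>j=m..<n + m. p j)"
      using sum.shift_bounds_nat_ivl[of p 0 m n] by (simp add: sum_subtractf lessThan_atLeast0)
    also have "\<dots> \<le> (\<Sum>j<n + m. p j) - (\<Sum>j=m..<n + m. p j)"
      by (intro diff_right_mono sum_mono2) (auto simp: p)
    also have "\<dots> = (\<Sum>j<m. p j)"
      using sum.atLeastLessThan_concat[of 0 m "n + m" p] by (simp add: lessThan_atLeast0)
    also have "\<dots> \<le> (\<Sum>j<m. 1)" by (intro sum_mono p)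
    finally have "2 * real m / A * (\<Sum>j<n. p j) \<le> real m" by simp
    then show ?thesis using A m by (simp add: field_simps)
  qed
  then have "(\<Sum>j<n. ennreal (p j)) \<le> ennreal (A / 2)" for n
    using p(1) by (simp add: sum_ennreal ennreal_leI)
  then have "(\<Sum>j. ennreal (p j)) \<le> ennreal (A / 2)"
    by (intro suminf_le_const summableI)
  with sum have "ennreal A \<le> ennreal (A / 2)" by (rule order_trans)
  then show False using A by (subst (asm) ennreal_le_iff) auto
qed

context change_point_model
begin

text \<open>
  Completing the square: a power of a Gaussian likelihood ratio is, up to a constant, the likelihood
  ratio for the rescaled mean.
\<close>
lemma log_lr_power:
  assumes "1 \<le> \<nu>"
  shows "(1 + s) * log_lr \<mu> \<nu> (\<nu> + m - 1) x =
     log_lr ((1 + s) *\<^sub>R \<mu>) \<nu> (\<nu> + m - 1) x + (s + s\<^sup>2) * real m * information \<mu>"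
proof -
  have card: "card {\<nu>..\<nu> + m - Suc 0} = m" using assms by simp
  have "(1 + s) * log_lr \<mu> \<nu> (\<nu> + m - 1) x =
     (\<Sum>i\<in>{\<nu>..\<nu> + m - 1}. (\<Sum>k\<in>UNIV. ((1 + s) *\<^sub>R \<mu>) $ k * X k i x - (((1 + s) *\<^sub>R \<mu>) $ k)\<^sup>2 / 2)
        + (s + s\<^sup>2) * information \<mu>)"
    unfolding log_lr_def information_def sum_distrib_left sum_divide_distrib sum.distrib[symmetric]
    by (intro sum.cong refl) (simp add: algebra_simps power2_eq_square add_divide_distrib)
  also have "\<dots> = log_lr ((1 + s) *\<^sub>R \<mu>) \<nu> (\<nu> + m - 1) x + (s + s\<^sup>2) * real m * information \<mu>"
    unfolding sum.distrib log_lr_def by (simp add: card del: card_atLeastAtMost)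
  finally show ?thesis .
qed

text \<open>
  The likelihood ratio \<open>exp \<ell>\<close> is split at the level \<open>exp c\<close>. Above this level it is at most
  \<open>exp ((1 + s) \<ell> - s c)\<close>, whose integral over \<open>G\<close> is, up to a constant, the probability of \<open>G\<close> under a
  change to \<open>(1 + s) \<mu>\<close>; as \<open>G\<close> is decided before \<open>\<nu>\<close>, that is its probability without a change.
\<close>
lemma P_mass_bound:
  assumes \<nu>: "1 \<le> \<nu>" and s: "0 < s"
    and G: "G \<in> sets (obs_filtration Pinf X (enat (\<nu> - 1)))"
    and E: "E \<in> sets (obs_filtration Pinf X (enat (\<nu> + m - 1)))" and EG: "E \<subseteq> G"
  shows "measure (P \<mu> \<nu>) E \<le> exp c * measure Pinf E
     + exp ((s + s\<^sup>2) * real m * information \<mu> - s * c) * measure Pinf G"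
proof -
  interpret Pinf: gaussian_streams Pinf X "\<lambda>k n. 0" by (rule gaussian_Pinf)
  interpret Q: gaussian_streams "P \<mu> \<nu>" X "\<lambda>k n. if n < \<nu> then 0 else \<mu> $ k" by (rule gaussian_P[OF \<nu>])
  let ?n = "\<nu> + m - 1" and ?\<mu>' = "(1 + s) *\<^sub>R \<mu>"
  let ?b = "exp ((s + s\<^sup>2) * real m * information \<mu> - s * c)"
  have [measurable]: "E \<in> sets Pinf" "G \<in> sets Pinf" using Pinf.obs_sets E G by auto
  have [measurable]: "log_lr \<mu>' \<nu> i \<in> borel_measurable Pinf" for \<mu>' i by (rule measurable_log_lr[OF \<nu>])
  have G': "G \<in> sets (obs_filtration Pinf X (enat ?n))"
    by (rule subsetD[OF sets_obs_filtration_mono G]) (simp add: diff_le_mono)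
  have pt: "exp (log_lr \<mu> \<nu> ?n x) \<le> exp c + ?b * exp (log_lr ?\<mu>' \<nu> ?n x)" for x
  proof -
    let ?l = "log_lr \<mu> \<nu> ?n x"
    have "?b * exp (log_lr ?\<mu>' \<nu> ?n x) = exp ((1 + s) * ?l - s * c)"
      unfolding log_lr_power[OF \<nu>] by (simp add: exp_add[symmetric] algebra_simps)
    moreover have "exp ?l \<le> exp ((1 + s) * ?l - s * c)" if "c < ?l"
      using mult_strict_left_mono[OF that s] by (simp add: algebra_simps)
    moreover have "exp ?l \<le> exp c" if "\<not> c < ?l" using that by simp
    ultimately show ?thesis by (smt (verit) exp_ge_zero)
  qed
  have "emeasure (P \<mu> \<nu>) E = (\<integral>\<^sup>+x\<in>E. ennreal (exp (log_lr \<mu> \<nu> ?n x)) \<partial>Pinf)"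
    by (rule P_eq_nn_integral[OF \<nu> E])
  also have "\<dots> \<le> (\<integral>\<^sup>+x. ennreal (exp c) * indicator E x + ennreal ?b * (ennreal (exp (log_lr ?\<mu>' \<nu> ?n x)) * indicator G x) \<partial>Pinf)"
  proof (rule nn_integral_mono)
    fix x
    have "ennreal (exp (log_lr \<mu> \<nu> ?n x)) \<le> ennreal (exp c) + ennreal ?b * ennreal (exp (log_lr ?\<mu>' \<nu> ?n x))"
      using ennreal_leI[OF pt[of x]] by (simp add: ennreal_plus ennreal_mult')
    then show "ennreal (exp (log_lr \<mu> \<nu> ?n x)) * indicator E x \<le>
       ennreal (exp c) * indicator E x + ennreal ?b * (ennreal (exp (log_lr ?\<mu>' \<nu> ?n x)) * indicator G x)"
      using EG by (auto split: split_indicator)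
  qed
  also have "\<dots> = ennreal (exp c) * emeasure Pinf E + ennreal ?b * (\<integral>\<^sup>+x\<in>G. ennreal (exp (log_lr ?\<mu>' \<nu> ?n x)) \<partial>Pinf)"
    by (subst nn_integral_add) (auto simp: nn_integral_cmult nn_integral_cmult_indicator)
  also have "(\<integral>\<^sup>+x\<in>G. ennreal (exp (log_lr ?\<mu>' \<nu> ?n x)) \<partial>Pinf) = emeasure (P ?\<mu>' \<nu>) G"
    by (rule P_eq_nn_integral[OF \<nu> G', symmetric])
  also have "\<dots> = emeasure Pinf G"
    using \<nu> by (intro P_eq_Pinf_before_change[OF \<nu> _ G]) simp
  finally have "ennreal (measure (P \<mu> \<nu>) E) \<le> ennreal (exp c * measure Pinf E + ?b * measure Pinf G)"
    unfolding Q.emeasure_eq_measure Pinf.emeasure_eq_measure by (simp add: ennreal_plus ennreal_mult')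
  then show ?thesis by (subst (asm) ennreal_le_iff) (auto intro!: add_nonneg_nonneg)
qed

text \<open>
  The essential supremum at the time \<open>\<nu>\<close> of low hazard dominates the mean of \<open>T - \<nu> + 1\<close> given \<open>T \<ge> \<nu>\<close>,
  and this mean is at least \<open>m\<close> times the conditional probability that \<open>T\<close> survives \<open>m\<close> further steps.
\<close>
theorem detection_delay_lower_bound:
  assumes T: "stopping_time (obs_filtration Pinf X) T"
    and A: "0 < A" "ennreal A \<le> (\<integral>\<^sup>+x. ennreal_of_enat (T x) \<partial>Pinf)"
    and m: "0 < m" and s: "0 < s"
  shows "ennreal (real m * (1 - exp c * (2 * real m / A) - exp ((s + s\<^sup>2) * real m * information \<mu> - s * c)))
     \<le> detection_delay X (P \<mu>) T"
proof -
  interpret Pinf: gaussian_streams Pinf X "\<lambda>k n. 0" by (rule gaussian_Pinf)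
  let ?b = "exp ((s + s\<^sup>2) * real m * information \<mu> - s * c)"
  define G where "G j = {x \<in> space Pinf. enat j < T x}" for j
  have GF: "G j \<in> sets (obs_filtration Pinf X (enat j))" for j
    unfolding G_def by (rule stopping_time_sets(2)[OF T])
  have Gmono: "G j \<subseteq> G i" if "i \<le> j" for i j
    unfolding G_def using that by clarsimp (metis enat_ord_simps(1) le_less_trans)
  have Tm: "T \<in> measurable Pinf (count_space UNIV)" by (rule Pinf.stopping_time_measurable[OF T])
  have "(\<integral>\<^sup>+x. ennreal_of_enat (T x) \<partial>Pinf) = (\<Sum>j. emeasure Pinf (G j))"
    unfolding G_def by (rule nn_integral_enat_function[OF Tm])
  then have "ennreal A \<le> (\<Sum>j. ennreal (measure Pinf (G j)))" using A(2) by (simp add: Pinf.emeasure_eq_measure)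
  moreover have "measure Pinf (G j) \<le> measure Pinf (G i)" if "i \<le> j" for i j
    using Gmono[OF that] Pinf.obs_sets[OF GF] by (rule Pinf.finite_measure_mono)
  ultimately obtain j where j: "0 < measure Pinf (G j)"
      "measure Pinf (G j) - measure Pinf (G (j + m)) \<le> 2 * real m / A * measure Pinf (G j)"
    using exists_low_hazard_time[of "\<lambda>j. measure Pinf (G j)" A m] A(1) m Pinf.prob_le_1 measure_nonneg by meson
  define \<nu> where "\<nu> = Suc j"
  have \<nu>: "1 \<le> \<nu>" "\<nu> - 1 = j" "\<nu> + m - 1 = j + m" unfolding \<nu>_def by auto
  interpret Q: gaussian_streams "P \<mu> \<nu>" X "\<lambda>k n. if n < \<nu> then 0 else \<mu> $ k" by (rule gaussian_P[OF \<nu>(1)])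
  let ?Q = "P \<mu> \<nu>"
  have [measurable]: "G i \<in> sets ?Q" for i
    using Pinf.obs_sets[OF GF] sets_P[OF \<nu>(1)] by simp
  have Gsub: "G (j + m) \<subseteq> G j" by (rule Gmono) simp
  let ?E = "G j - G (j + m)"
  have EF: "?E \<in> sets (obs_filtration Pinf X (enat (j + m)))"
    using GF[of j] GF[of "j + m"] sets_obs_filtration_mono[of "enat j" "enat (j + m)" Pinf X] by auto
  have QG: "measure ?Q (G j) = measure Pinf (G j)"
    using P_eq_Pinf_before_change[OF \<nu>(1) _ GF, of j \<mu>] unfolding \<nu>_def measure_def by simp
  have "measure ?Q ?E \<le> exp c * measure Pinf ?E + ?b * measure Pinf (G j)"
    using GF EF by (intro P_mass_bound[OF \<nu>(1) s]) (auto simp only: \<nu>(2,3))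
  also have "measure Pinf ?E = measure Pinf (G j) - measure Pinf (G (j + m))"
    using Gsub Pinf.obs_sets[OF GF] by (intro Pinf.finite_measure_Diff) auto
  also have "exp c * \<dots> \<le> exp c * (2 * real m / A * measure Pinf (G j))"
    using j(2) by (intro mult_left_mono) auto
  finally have 1: "measure ?Q ?E \<le> (exp c * (2 * real m / A) + ?b) * measure ?Q (G j)"
    by (simp add: QG algebra_simps)
  have "measure ?Q (G (j + m)) = measure ?Q (G j) - measure ?Q ?E"
    using Gsub by (subst Q.finite_measure_Diff) auto
  with 1 have 2: "(1 - exp c * (2 * real m / A) - ?b) * measure ?Q (G j) \<le> measure ?Q (G (j + m))"
    by (simp add: algebra_simps)
  define M where "M = uniform_measure ?Q (G j)"
  have Gpos: "emeasure ?Q (G j) \<noteq> 0" "emeasure ?Q (G j) \<noteq> \<infinity>"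
    using j(1) QG by (auto simp: Q.emeasure_eq_measure)
  interpret M: prob_space M unfolding M_def by (rule prob_space_uniform_measure[OF Gpos])
  let ?F = "obs_filtration M X (enat (\<nu> - 1))"
  have [simp]: "sets M = sets ?Q" "space M = space ?Q" unfolding M_def by simp_all
  have "subalgebra M (obs_filtration ?Q X (enat (\<nu> - 1)))"
    using Q.subalgebra_obs by (simp add: subalgebra_def)
  then have sub: "subalgebra M ?F" using obs_filtration_cong[of M ?Q X] by simp
  interpret S: finite_measure_subalgebra M ?F by (unfold_locales) (rule sub)
  have TQ: "T \<in> measurable ?Q (count_space UNIV)"
    using Tm measurable_cong_sets[OF sets_P[OF \<nu>(1), of \<mu>] refl] by blast
  let ?f = "\<lambda>x. ennreal_of_enat (T x - enat \<nu> + 1)"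
  have fm [measurable]: "?f \<in> borel_measurable ?Q"
    using measurable_compose[OF TQ, of "\<lambda>t. ennreal_of_enat (t - enat \<nu> + 1)" borel] by simp
  have fM: "?f \<in> borel_measurable M" using fm measurable_cong_sets[of M ?Q borel borel] by auto
  have lower: "ennreal (real m) \<le> ?f x" if "x \<in> G (j + m)" for x
  proof (cases "T x")
    case (enat t)
    with that show ?thesis unfolding G_def \<nu>_def
      by (simp add: one_enat_def ennreal_of_nat_eq_real_of_nat)
  qed (simp add: G_def)
  have "ennreal (real m * (1 - exp c * (2 * real m / A) - ?b)) \<le> ennreal (real m * (measure ?Q (G (j + m)) / measure ?Q (G j)))"
    using 2 j(1) QG by (intro ennreal_leI mult_left_mono) (auto simp: field_simps)
  also have "\<dots> = (\<integral>\<^sup>+x. ennreal (real m) * indicator (G (j + m)) x \<partial>?Q) / emeasure ?Q (G j)"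
    using j(1) QG by (subst nn_integral_cmult_indicator)
      (auto simp: Q.emeasure_eq_measure ennreal_mult'[symmetric] divide_ennreal)
  also have "\<dots> \<le> (\<integral>\<^sup>+x. ?f x * indicator (G j) x \<partial>?Q) / emeasure ?Q (G j)"
    using lower Gsub by (intro divide_right_mono_ennreal nn_integral_mono) (auto split: split_indicator)
  also have "\<dots> = (\<integral>\<^sup>+x. ?f x \<partial>M)"
    unfolding M_def by (rule nn_integral_uniform_measure[OF fm, symmetric]) measurable
  also have "\<dots> \<le> esssup M (nn_cond_exp M ?F ?f)"
    by (rule S.nn_integral_le_esssup_cond_exp[OF M.prob_space_axioms fM])
  also have "\<dots> \<le> detection_delay X (P \<mu>) T"
  proof -
    have "{x \<in> space ?Q. enat \<nu> \<le> T x} = G j"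
      unfolding G_def \<nu>_def using space_P[OF \<nu>(1), of \<mu>] by (auto simp: \<nu>_def Suc_ile_eq)
    then have "M = uniform_measure ?Q {x \<in> space ?Q. enat \<nu> \<le> T x}" unfolding M_def by simp
    then show ?thesis unfolding detection_delay_def Let_def
      using \<nu>(1) by (intro SUP_upper2[of \<nu>]) auto
  qed
  finally show ?thesis .
qed

end

section \<open>The adaptive one-sided test after the change\<close>

text \<open>
  Up to its first crossing the sum stays below \<open>a\<close>, and the crossing step adds at most \<open>K + b l\<close>. The
  last sum counts \<open>b\<close> over all steps taken, rather than only over the crossing step, because its
  expectation is then easy to compute.
\<close>
lemma stopped_sum_bound:
  fixes z b :: "nat \<Rightarrow> real"
  assumes a: "0 \<le> a" and K: "0 \<le> K" and b: "\<And>l. 0 \<le> b l" and z: "\<And>l. z l \<le> K + b l"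
    and g: "\<And>l. g l \<longleftrightarrow> (\<forall>n\<in>{\<nu>..<l}. (\<Sum>i\<in>{\<nu>..n}. z i) < a)" and L: "\<nu> \<le> L"
  shows "(\<Sum>l\<in>{\<nu>..<L}. of_bool (g l) * z l) \<le> a + K + (\<Sum>l\<in>{\<nu>..<L}. of_bool (g l) * b l)"
  using L
proof (induction L rule: dec_induct)
  case base
  then show ?case using a K by simp
next
  case (step L)
  show ?case
  proof (cases "g L")
    case True
    have "(\<Sum>l\<in>{\<nu>..<L}. of_bool (g l) * z l) = (\<Sum>l\<in>{\<nu>..<L}. z l)"
      using True by (intro sum.cong) (auto simp: g)
    also have "\<dots> \<le> a"
    proof (cases "L = \<nu>")
      case False
      then have "L - 1 \<in> {\<nu>..<L}" "{\<nu>..L - 1} = {\<nu>..<L}" using step.hyps by auto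
      then show ?thesis using True unfolding g by (metis less_imp_le)
    qed (use a in simp)
    finally have "(\<Sum>l\<in>{\<nu>..<L}. of_bool (g l) * z l) \<le> a" .
    moreover have "0 \<le> (\<Sum>l\<in>{\<nu>..<L}. of_bool (g l) * b l)" by (intro sum_nonneg) (simp add: b)
    ultimately show ?thesis using True step.hyps z[of L] by simp
  next
    case False
    then show ?thesis using step by simp
  qed
qed

text \<open>
  Setting a coordinate to 0 is harmless if \<open>\<mu> = 0\<close>. Otherwise it happens only when the sample mean
  misses \<open>\<mu>\<close> by more than the gap \<open>|\<mu>| - \<omega>\<close>, and then the error \<open>|\<mu>|\<close> is at most \<open>|\<mu>| / (|\<mu>| - \<omega>)\<close> times the
  error of the sample mean.
\<close>
lemma hard_estimate_error:
  assumes \<omega>: "0 < \<omega> k" and \<mu>: "\<mu> = 0 \<or> \<omega> k < \<bar>\<mu>\<bar>" and "m < l"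
  shows "\<bar>hard_estimate \<omega> y k m l - \<mu>\<bar> \<le> (1 + \<bar>\<mu>\<bar> / \<bar>\<bar>\<mu>\<bar> - \<omega> k\<bar>) * \<bar>window_mean y k m l - \<mu>\<bar>"
proof (cases "\<omega> k \<le> \<bar>window_mean y k m l\<bar>")
  case True
  have "1 * \<bar>window_mean y k m l - \<mu>\<bar> \<le> (1 + \<bar>\<mu>\<bar> / \<bar>\<bar>\<mu>\<bar> - \<omega> k\<bar>) * \<bar>window_mean y k m l - \<mu>\<bar>"
    by (intro mult_right_mono) auto
  with True \<open>m < l\<close> show ?thesis by (simp add: hard_estimate_def)
next
  case False
  show ?thesis
  proof (cases "\<mu> = 0")
    case True
    with False show ?thesis by (simp add: hard_estimate_def)
  next
    case nz: False
    with \<mu> have d: "0 < \<bar>\<mu>\<bar> - \<omega> k" by simp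
    have "\<bar>\<mu>\<bar> = \<bar>\<mu>\<bar> / \<bar>\<bar>\<mu>\<bar> - \<omega> k\<bar> * (\<bar>\<mu>\<bar> - \<omega> k)" using d by simp
    also have "\<dots> \<le> \<bar>\<mu>\<bar> / \<bar>\<bar>\<mu>\<bar> - \<omega> k\<bar> * \<bar>window_mean y k m l - \<mu>\<bar>"
      using False by (intro mult_left_mono) auto
    also have "\<dots> \<le> (1 + \<bar>\<mu>\<bar> / \<bar>\<bar>\<mu>\<bar> - \<omega> k\<bar>) * \<bar>window_mean y k m l - \<mu>\<bar>"
      by (intro mult_right_mono) auto
    finally show ?thesis using False by (simp add: hard_estimate_def)
  qed
qed

lemma sum_inverse_squares_le: "(\<Sum>n\<in>{1..<L}. 1 / (real n)\<^sup>2) \<le> 2"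
proof -
  have "(\<Sum>n\<in>{1..<Suc L}. 1 / (real n)\<^sup>2) \<le> 2 - 1 / real L" if "1 \<le> L" for L
    using that
  proof (induction L rule: dec_induct)
    case (step n)
    have "1 / (real (Suc n))\<^sup>2 \<le> 1 / (real n * real (Suc n))"
      using step.hyps by (intro divide_left_mono) (auto simp: power2_eq_square)
    also have "\<dots> = 1 / real n - 1 / real (Suc n)" using step.hyps by (simp add: field_simps)
    finally show ?case using step.IH by simp
  qed simp
  note * = this
  show ?thesis
  proof (cases "2 \<le> L")
    case True
    with *[of "L - 1"] have "(\<Sum>n\<in>{1..<L}. 1 / (real n)\<^sup>2) \<le> 2 - 1 / real (L - 1)" by simp
    also have "\<dots> \<le> 2" by simp
    finally show ?thesis .
  qed simp
qed

lemma (in prob_space) normal_fourth_moment: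
  assumes "distributed M lborel Y (normal_density m \<sigma>)" and "0 < \<sigma>"
  shows "integrable M (\<lambda>x. (Y x - m) ^ 4)" "expectation (\<lambda>x. (Y x - m) ^ 4) = 3 * \<sigma> ^ 4"
proof -
  have *: "has_bochner_integral lborel (\<lambda>y. normal_density m \<sigma> y * (y - m) ^ 4) (3 * \<sigma> ^ 4)"
    using normal_moment_even[of \<sigma> m 2] assms(2) by (simp add: fact_numeral power_divide power_mult[symmetric])
  show "integrable M (\<lambda>x. (Y x - m) ^ 4)"
    using * assms by (subst distributed_integrable[OF assms(1), symmetric]) (auto simp: has_bochner_integral_iff)
  show "expectation (\<lambda>x. (Y x - m) ^ 4) = 3 * \<sigma> ^ 4"
    using * assms by (subst distributed_integral[OF assms(1), symmetric]) (auto simp: has_bochner_integral_iff)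
qed

context gaussian_streams
begin

lemma X_mean:
  assumes "1 \<le> n"
  shows "integrable M (X k n)" "expectation (X k n) = \<theta> k n"
proof -
  show "integrable M (X k n)"
    using integrable_normal_moment_nz_1 distributed_integrable[OF normal[OF assms], of "\<lambda>y. y"] by simp
  show "expectation (X k n) = \<theta> k n"
    using distributed_integral[OF normal[OF assms], of "\<lambda>y. y"] by (simp add: integral_normal_moment_nz_1)
qed

lemma window_mean_fourth_moment:
  assumes \<nu>: "1 \<le> \<nu>" "\<nu> < l" and \<theta>: "\<And>n. \<nu> \<le> n \<Longrightarrow> \<theta> k n = \<mu>"
  shows "integrable M (\<lambda>x. (window_mean (\<lambda>k i. X k i x) k \<nu> l - \<mu>) ^ 4)"
    "expectation (\<lambda>x. (window_mean (\<lambda>k i. X k i x) k \<nu> l - \<mu>) ^ 4) = 3 / (real (l - \<nu>))\<^sup>2"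
proof -
  let ?n = "real (l - \<nu>)"
  let ?S = "\<lambda>x. \<Sum>i\<in>{\<nu>..<l}. X k i x"
  have n: "0 < ?n" using \<nu> by simp
  have "distributed M lborel ?S (normal_density (\<Sum>i\<in>{\<nu>..<l}. \<mu>) (sqrt (\<Sum>i\<in>{\<nu>..<l}. 1\<^sup>2)))"
  proof (rule sum_indep_normal)
    fix i assume "i \<in> {\<nu>..<l}"
    then show "distributed M lborel (X k i) (normal_density \<mu> 1)"
      using normal[of i k] \<theta>[of i] \<nu> by simp
  qed (use \<nu> indep_in_stream[of \<nu> k l] in auto)
  then have S: "distributed M lborel ?S (normal_density (?n * \<mu>) (sqrt ?n))" by simp
  have eq: "(window_mean (\<lambda>k i. X k i x) k \<nu> l - \<mu>) ^ 4 = (?S x - ?n * \<mu>) ^ 4 / ?n ^ 4" for x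
  proof -
    have "window_mean (\<lambda>k i. X k i x) k \<nu> l - \<mu> = (?S x - ?n * \<mu>) / ?n"
      using n unfolding window_mean_def by (simp add: diff_divide_distrib)
    then show ?thesis by (simp add: power_divide)
  qed
  have sq: "sqrt ?n ^ 4 = ?n\<^sup>2" using n power_mult[of "sqrt ?n" 2 2] by simp
  show "integrable M (\<lambda>x. (window_mean (\<lambda>k i. X k i x) k \<nu> l - \<mu>) ^ 4)"
    unfolding eq using normal_fourth_moment(1)[OF S] n by simp
  show "expectation (\<lambda>x. (window_mean (\<lambda>k i. X k i x) k \<nu> l - \<mu>) ^ 4) = 3 / ?n\<^sup>2"
  proof -
    have "expectation (\<lambda>x. (?S x - ?n * \<mu>) ^ 4) = 3 * ?n\<^sup>2"
      using normal_fourth_moment(2)[OF S] n unfolding sq by simp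
    moreover have "3 * t\<^sup>2 / t ^ 4 = 3 / t\<^sup>2" if "0 < t" for t :: real
      using that by (simp add: field_simps power_add[of t 2 2, simplified])
    ultimately show ?thesis unfolding eq integral_divide_zero using n by simp
  qed
qed

text \<open>
  Summability is the point: the fourth powers of the estimation errors add up to a bounded amount over
  arbitrarily long runs, so they do not affect the first order of the delay. The term \<open>\<mu> ^ 4\<close> comes from the initial estimate 0,
  the other one from the moments \<open>3 / (l - \<nu>)\<^sup>2\<close> of the sample means.
\<close>
lemma hard_estimate_fourth_moment:
  assumes \<omega>: "0 < \<omega> k" and \<mu>: "\<mu> = 0 \<or> \<omega> k < \<bar>\<mu>\<bar>"
    and \<nu>: "1 \<le> \<nu>" and \<theta>: "\<And>n. \<nu> \<le> n \<Longrightarrow> \<theta> k n = \<mu>"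
  defines "c \<equiv> (1 + \<bar>\<mu>\<bar> / \<bar>\<bar>\<mu>\<bar> - \<omega> k\<bar>) ^ 4"
  shows "integrable M (\<lambda>x. (hard_estimate \<omega> (\<lambda>k i. X k i x) k \<nu> l - \<mu>) ^ 4)"
    "(\<Sum>l\<in>{\<nu>..<L}. expectation (\<lambda>x. (hard_estimate \<omega> (\<lambda>k i. X k i x) k \<nu> l - \<mu>) ^ 4)) \<le> \<mu> ^ 4 + 6 * c"
proof -
  let ?h = "\<lambda>l x. hard_estimate \<omega> (\<lambda>k i. X k i x) k \<nu> l - \<mu>"
  let ?w = "\<lambda>l x. window_mean (\<lambda>k i. X k i x) k \<nu> l - \<mu>"
  have c: "0 \<le> c" unfolding c_def by (intro zero_le_power) auto
  have bound: "?h l x ^ 4 \<le> c * ?w l x ^ 4" if "\<nu> < l" for l x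
  proof -
    have "\<bar>?h l x\<bar> ^ 4 \<le> ((1 + \<bar>\<mu>\<bar> / \<bar>\<bar>\<mu>\<bar> - \<omega> k\<bar>) * \<bar>?w l x\<bar>) ^ 4"
      by (rule power_mono[OF hard_estimate_error[where \<omega> = \<omega> and k = k, OF \<omega> \<mu> that]]) simp
    then show ?thesis by (simp add: c_def power_mult_distrib power_even_abs)
  qed
  have init: "?h l x = - \<mu>" if "l \<le> \<nu>" for l x
    using that by (simp add: hard_estimate_def)
  have m: "(\<lambda>x. ?h l x ^ 4) \<in> borel_measurable M" for l
    using \<nu> by (intro borel_measurable_power borel_measurable_diff measurable_hard_estimate X_measurable) auto
  show int: "integrable M (\<lambda>x. ?h l x ^ 4)" for l
  proof (cases "\<nu> < l")
    case True
    show ?thesis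
      by (rule Bochner_Integration.integrable_bound
          [OF integrable_mult_right[of c, OF window_mean_fourth_moment(1)[OF \<nu> True \<theta>]] m])
         (use bound[OF True] in \<open>auto intro: order_trans[OF _ abs_ge_self]\<close>)
  qed (simp add: init)
  have e: "expectation (\<lambda>x. ?h l x ^ 4) \<le> 3 * c * (1 / (real (l - \<nu>))\<^sup>2)" if "\<nu> < l" for l
  proof -
    have "expectation (\<lambda>x. ?h l x ^ 4) \<le> expectation (\<lambda>x. c * ?w l x ^ 4)"
      using bound[OF that] int integrable_mult_right[of c, OF window_mean_fourth_moment(1)[OF \<nu> that \<theta>]]
      by (intro integral_mono) auto
    also have "\<dots> = 3 * c * (1 / (real (l - \<nu>))\<^sup>2)"
      using window_mean_fourth_moment(2)[OF \<nu> that \<theta>] by simp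
    finally show ?thesis .
  qed
  show "(\<Sum>l\<in>{\<nu>..<L}. expectation (\<lambda>x. ?h l x ^ 4)) \<le> \<mu> ^ 4 + 6 * c"
  proof (cases "\<nu> < L")
    case True
    have "(\<Sum>l\<in>{\<nu>..<L}. expectation (\<lambda>x. ?h l x ^ 4)) =
        \<mu> ^ 4 + (\<Sum>l\<in>{Suc \<nu>..<L}. expectation (\<lambda>x. ?h l x ^ 4))"
      using True by (simp add: sum.atLeast_Suc_lessThan init prob_space)
    also have "\<dots> \<le> \<mu> ^ 4 + (\<Sum>l\<in>{Suc \<nu>..<L}. 3 * c * (1 / (real (l - \<nu>))\<^sup>2))"
      by (intro add_left_mono sum_mono e) auto
    also have "(\<Sum>l\<in>{Suc \<nu>..<L}. 3 * c * (1 / (real (l - \<nu>))\<^sup>2)) = 3 * c * (\<Sum>n\<in>{1..<L - \<nu>}. 1 / (real n)\<^sup>2)"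
      using sum.shift_bounds_nat_ivl[of "\<lambda>l. 3 * c * (1 / (real (l - \<nu>))\<^sup>2)" 1 \<nu> "L - \<nu>"] True
      by (simp add: sum_distrib_left)
    also have "\<dots> \<le> 3 * c * 2"
      using c by (intro mult_left_mono sum_inverse_squares_le) auto
    finally show ?thesis by simp
  next
    case False
    then show ?thesis using c by simp
  qed
qed

end

lemma likelihood_ratio_le_SR:
  assumes "1 \<le> m" "m \<le> n"
  shows "likelihood_ratio \<omega> y n m \<le> SR_statistic \<omega> y n"
  unfolding SR_statistic_def using assms
  by (intro member_le_sum) (auto intro: less_imp_le likelihood_ratio_pos)

context gaussian_streams
begin

text \<open>
  The estimate \<open>h\<close> and the event \<open>G\<close> are known before \<open>X k l\<close> is observed. Hence \<open>X k l\<close> may be replaced by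
  its mean \<open>\<mu>\<close>, which turns the increment into \<open>\<mu>\<^sup>2 / 2 - (h - \<mu>)\<^sup>2 / 2\<close>. The loss \<open>(h - \<mu>)\<^sup>2 / 2\<close> is at most
  \<open>d + (h - \<mu>) ^ 4 / (16 d)\<close> by the arithmetic-geometric mean inequality: the first part is a small
  fraction of the drift, the second is summable over time.
\<close>
lemma increment_mean_lower_bound:
  fixes \<omega> :: "'k \<Rightarrow> real"
  assumes \<nu>: "1 \<le> \<nu>" "\<nu> \<le> l" and G: "G \<in> sets (obs_filtration M X (enat (l - 1)))"
    and \<theta>: "\<theta> k l = \<mu>" and d: "0 < d"
  defines "h \<equiv> \<lambda>x. hard_estimate \<omega> (\<lambda>k i. X k i x) k \<nu> l"
  assumes int: "integrable M (\<lambda>x. (h x - \<mu>) ^ 4)"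
  shows "integrable M (\<lambda>x. indicator G x * (h x * X k l x - (h x)\<^sup>2 / 2))"
    and "(\<mu>\<^sup>2 / 2 - d) * prob G - expectation (\<lambda>x. (h x - \<mu>) ^ 4) / (16 * d)
       \<le> expectation (\<lambda>x. indicator G x * (h x * X k l x - (h x)\<^sup>2 / 2))"
proof -
  have l: "1 \<le> l" "l - 1 < l" using \<nu> by auto
  have hF: "h \<in> borel_measurable (obs_filtration M X (enat (l - 1)))"
    unfolding h_def using \<nu> by (intro measurable_hard_estimate measurable_obs_filtration) auto
  have [measurable]: "h \<in> borel_measurable M" by (rule from_obs[OF hF])
  have [measurable]: "G \<in> sets M" by (rule obs_sets[OF G])
  define e where "e x = (h x - \<mu>) ^ 4" for x
  have e: "e x = ((h x - \<mu>)\<^sup>2)\<^sup>2" for x unfolding e_def by (simp add: power_mult[symmetric])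
  have inte: "integrable M e" using int unfolding e_def .
  have sq: "\<bar>t\<bar> \<le> 1 + t\<^sup>2" for t :: real
    using zero_le_power2[of "\<bar>t\<bar> - 1"] by (simp add: power2_eq_square algebra_simps)
  have sq2: "(h x - \<mu>)\<^sup>2 \<le> 1 + e x" for x unfolding e using sq[of "(h x - \<mu>)\<^sup>2"] by simp
  \<comment> \<open>All moments needed are dominated by the integrable fourth power of the error.\<close>
  have b1: "\<bar>h x\<bar> \<le> 2 + \<bar>\<mu>\<bar> + e x" for x using sq[of "h x - \<mu>"] sq2[of x] by linarith
  have b2: "(h x)\<^sup>2 \<le> 2 * (1 + e x) + 2 * \<mu>\<^sup>2" for x
  proof -
    have "(h x)\<^sup>2 \<le> 2 * (h x - \<mu>)\<^sup>2 + 2 * \<mu>\<^sup>2"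
      using zero_le_power2[of "h x - 2 * \<mu>"] by (simp add: power2_eq_square algebra_simps)
    also have "\<dots> \<le> 2 * (1 + e x) + 2 * \<mu>\<^sup>2"
      by (intro add_right_mono mult_left_mono sq2) simp
    finally show ?thesis .
  qed
  have e0: "0 \<le> e x" for x unfolding e by simp
  have i1: "integrable M (\<lambda>x. indicator G x * h x)"
    by (rule Bochner_Integration.integrable_bound[of _ "\<lambda>x. 2 + \<bar>\<mu>\<bar> + e x"])
      (use b1 e0 inte in \<open>auto split: split_indicator intro!: order_trans[OF _ abs_ge_self]\<close>)
  have i2: "integrable M (\<lambda>x. indicator G x * (h x)\<^sup>2)"
    by (rule Bochner_Integration.integrable_bound[of _ "\<lambda>x. 2 * (1 + e x) + 2 * \<mu>\<^sup>2"])
      (use b2 e0 inte in \<open>auto split: split_indicator intro!: order_trans[OF _ abs_ge_self]\<close>)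
  have ind: "indep_var borel (\<lambda>x. indicator G x * h x) borel (X k l)"
    using G hF by (intro indep_var_past_future[of _ "l - 1"] measurable_future l(2)) auto
  have i3: "integrable M (\<lambda>x. (indicator G x * h x) * X k l x)"
    by (rule indep_var_integrable[OF ind i1 X_mean(1)[OF l(1)]])
  have m3: "expectation (\<lambda>x. (indicator G x * h x) * X k l x) = expectation (\<lambda>x. indicator G x * h x) * \<mu>"
    using indep_var_lebesgue_integral[OF ind i1 X_mean(1)[OF l(1)]] X_mean(2)[OF l(1), of k] \<theta> by simp
  have eq: "(\<lambda>x. indicator G x * (h x * X k l x - (h x)\<^sup>2 / 2)) =
      (\<lambda>x. (indicator G x * h x) * X k l x - (indicator G x * (h x)\<^sup>2) / 2)"
    by (simp add: algebra_simps)
  show "integrable M (\<lambda>x. indicator G x * (h x * X k l x - (h x)\<^sup>2 / 2))"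
    unfolding eq using i2 i3 by (intro Bochner_Integration.integrable_diff) auto
  have pt: "(\<mu>\<^sup>2 / 2 - d) * indicator G x - e x / (16 * d) \<le> (indicator G x * h x) * \<mu> - (indicator G x * (h x)\<^sup>2) / 2" for x
  proof -
    have "0 \<le> (((h x - \<mu>)\<^sup>2) - 4 * d)\<^sup>2 / (16 * d)" using d by simp
    also have "\<dots> = e x / (16 * d) - (h x - \<mu>)\<^sup>2 / 2 + d"
      unfolding e using d by (simp add: field_simps power2_eq_square)
    finally have "(h x - \<mu>)\<^sup>2 / 2 \<le> d + e x / (16 * d)" by simp
    then have "\<mu>\<^sup>2 / 2 - d - e x / (16 * d) \<le> h x * \<mu> - (h x)\<^sup>2 / 2"
      by (simp add: power2_eq_square algebra_simps add_divide_distrib diff_divide_distrib)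
    then show ?thesis using d e0[of x] by (auto split: split_indicator)
  qed
  have "(\<mu>\<^sup>2 / 2 - d) * prob G - expectation e / (16 * d)
      = expectation (\<lambda>x. (\<mu>\<^sup>2 / 2 - d) * indicator G x - e x / (16 * d))"
    using inte by (subst Bochner_Integration.integral_diff) (auto simp: emeasure_eq_measure)
  also have "\<dots> \<le> expectation (\<lambda>x. (indicator G x * h x) * \<mu> - (indicator G x * (h x)\<^sup>2) / 2)"
    using inte i1 i2 pt by (intro integral_mono) (auto simp: emeasure_eq_measure)
  also have "\<dots> = expectation (\<lambda>x. indicator G x * h x) * \<mu> - expectation (\<lambda>x. indicator G x * (h x)\<^sup>2) / 2"
    using i1 i2 by (subst Bochner_Integration.integral_diff) auto
  also have "\<dots> = expectation (\<lambda>x. indicator G x * (h x * X k l x - (h x)\<^sup>2 / 2))"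
    unfolding eq using i2 i3 m3 by (subst Bochner_Integration.integral_diff) auto
  finally show "(\<mu>\<^sup>2 / 2 - d) * prob G - expectation (\<lambda>x. (h x - \<mu>) ^ 4) / (16 * d)
       \<le> expectation (\<lambda>x. indicator G x * (h x * X k l x - (h x)\<^sup>2 / 2))"
    unfolding e_def .
qed

text \<open>
  This controls the overshoot: the event \<open>G\<close> that step \<open>l\<close> is taken is independent of \<open>X k l\<close>.
\<close>
lemma past_times_fourth_moment:
  assumes l: "1 \<le> l" and G: "G \<in> sets (obs_filtration M X (enat (l - 1)))"
  shows "integrable M (\<lambda>x. indicator G x * (X k l x - \<theta> k l) ^ 4)"
    and "expectation (\<lambda>x. indicator G x * (X k l x - \<theta> k l) ^ 4) = 3 * prob G"
proof -
  have [measurable]: "G \<in> sets M" by (rule obs_sets[OF G])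
  note m4 = normal_fourth_moment[OF normal[OF l], of k, simplified]
  have [measurable]: "X k l \<in> borel_measurable (future (l - 1))" using l by (intro measurable_future) auto
  have ind: "indep_var borel (indicator G) borel (\<lambda>x. (X k l x - \<theta> k l) ^ 4)"
    by (rule indep_var_past_future[OF borel_measurable_indicator[OF G]]) measurable
  have i: "integrable M (indicator G :: _ \<Rightarrow> real)" by (simp add: emeasure_eq_measure)
  show "integrable M (\<lambda>x. indicator G x * (X k l x - \<theta> k l) ^ 4)"
    by (rule indep_var_integrable[OF ind i m4(1)])
  show "expectation (\<lambda>x. indicator G x * (X k l x - \<theta> k l) ^ 4) = 3 * prob G"
    using indep_var_lebesgue_integral[OF ind i m4(1)] m4(2) by simp
qed

text \<open>
  The one-sided test that starts at \<open>\<nu>\<close> and waits for \<open>\<Lambda>\<^sub>n\<^sub>,\<^sub>\<nu> \<ge> A\<close> still takes the observation at time \<open>l\<close>.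
  The sum over \<open>l\<close> of the probabilities of these events is its expected duration.
\<close>
definition running :: "('k \<Rightarrow> real) \<Rightarrow> real \<Rightarrow> nat \<Rightarrow> nat \<Rightarrow> 'a set" where
  "running \<omega> A \<nu> l = {x \<in> space M. \<forall>n\<in>{\<nu>..<l}. likelihood_ratio \<omega> (\<lambda>k i. X k i x) n \<nu> < A}"

text \<open>
  This makes the observation at time \<open>l\<close> independent of the decision to take it.
\<close>
lemma running_past:
  assumes "1 \<le> \<nu>" "\<nu> \<le> l"
  shows "running \<omega> A \<nu> l \<in> sets (obs_filtration M X (enat (l - 1)))"
proof -
  have [measurable]: "(\<lambda>x. likelihood_ratio \<omega> (\<lambda>k i. X k i x) n \<nu>) \<in> borel_measurable (obs_filtration M X (enat (l - 1)))"
    if "n \<in> {\<nu>..<l}" for n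
    using that assms by (intro measurable_likelihood_ratio measurable_obs_filtration) auto
  have "{x \<in> space (obs_filtration M X (enat (l - 1))). \<forall>n\<in>{\<nu>..<l}. likelihood_ratio \<omega> (\<lambda>k i. X k i x) n \<nu> < A}
      \<in> sets (obs_filtration M X (enat (l - 1)))"
    by measurable
  then show ?thesis by (simp add: running_def)
qed

text \<open>
  This makes the test independent of everything that precedes the change.
\<close>
lemma running_future:
  assumes "1 \<le> \<nu>"
  shows "running \<omega> A \<nu> l \<in> sets (future (\<nu> - 1))"
proof -
  have [measurable]: "(\<lambda>x. likelihood_ratio \<omega> (\<lambda>k i. X k i x) n \<nu>) \<in> borel_measurable (future (\<nu> - 1))" for n
    using assms by (intro measurable_likelihood_ratio measurable_future) auto
  have "{x \<in> space (future (\<nu> - 1)). \<forall>n\<in>{\<nu>..<l}. likelihood_ratio \<omega> (\<lambda>k i. X k i x) n \<nu> < A}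
      \<in> sets (future (\<nu> - 1))"
    by measurable
  then show ?thesis by (simp add: running_def)
qed

text \<open>
  The stopped sum of the increments of \<open>ln \<Lambda>\<close> is compared with its expectation. Each stream loses \<open>d\<close> per
  step through the estimation error and another \<open>d\<close> through the bound on the overshoot, whence the
  slope \<open>I - 2 K d\<close> for \<open>K\<close> streams. Uniformity in \<open>\<nu>\<close> and in the horizon \<open>L\<close> is what the supremum over the
  change times and the passage to an infinite horizon require.
\<close>
lemma expected_running_time_bound:
  fixes \<omega> \<mu> :: "'k \<Rightarrow> real"
  assumes \<omega>: "\<And>k. 0 < \<omega> k" and \<mu>: "\<And>k. \<mu> k = 0 \<or> \<omega> k < \<bar>\<mu> k\<bar>"
    and \<nu>: "1 \<le> \<nu>" "\<nu> \<le> L" and \<theta>: "\<And>k n. \<nu> \<le> n \<Longrightarrow> \<theta> k n = \<mu> k" and A: "1 \<le> A" and d: "0 < d"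
  shows "((\<Sum>k\<in>UNIV. (\<mu> k)\<^sup>2) / 2 - 2 * real CARD('k) * d) * (\<Sum>l\<in>{\<nu>..<L}. prob (running \<omega> A \<nu> l))
    \<le> ln A + (\<Sum>k\<in>UNIV. (\<mu> k)\<^sup>2 + 3 / (4 * d) + ((\<mu> k) ^ 4 + 6 * (1 + \<bar>\<mu> k\<bar> / \<bar>\<bar>\<mu> k\<bar> - \<omega> k\<bar>) ^ 4) / (16 * d))"
proof -
  let ?G = "running \<omega> A \<nu>" and ?h = "\<lambda>k l x. hard_estimate \<omega> (\<lambda>k i. X k i x) k \<nu> l"
  let ?c = "\<lambda>k. (\<mu> k) ^ 4 + 6 * (1 + \<bar>\<mu> k\<bar> / \<bar>\<bar>\<mu> k\<bar> - \<omega> k\<bar>) ^ 4"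
  let ?z = "\<lambda>k l x. ?h k l x * X k l x - (?h k l x)\<^sup>2 / 2"
  \<comment> \<open>The weight \<open>d / 3\<close> gives this fourth moment the expectation \<open>d\<close>.\<close>
  let ?q = "\<lambda>k l x. (X k l x - \<mu> k) ^ 4 * (d / 3)"
  let ?K = "\<Sum>k\<in>UNIV. (\<mu> k)\<^sup>2 + 3 / (4 * d)"
  have past: "?G l \<in> sets (obs_filtration M X (enat (l - 1)))" if "l \<in> {\<nu>..<L}" for l
    using that \<nu> by (intro running_past) auto
  note h4 = hard_estimate_fourth_moment[where \<omega> = \<omega>, OF \<omega> \<mu> \<nu>(1) \<theta>]
  have zint: "integrable M (\<lambda>x. indicator (?G l) x * ?z k l x)" if "l \<in> {\<nu>..<L}" for k l
    using that \<nu> \<theta> d h4(1) past[OF that] by (intro increment_mean_lower_bound(1)) auto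
  have zmean: "((\<mu> k)\<^sup>2 / 2 - d) * prob (?G l) - expectation (\<lambda>x. (?h k l x - \<mu> k) ^ 4) / (16 * d)
       \<le> expectation (\<lambda>x. indicator (?G l) x * ?z k l x)" if "l \<in> {\<nu>..<L}" for k l
    using that \<nu> \<theta> d h4(1) past[OF that] by (intro increment_mean_lower_bound(2)) auto
  have q: "integrable M (\<lambda>x. indicator (?G l) x * ?q k l x)"
      "expectation (\<lambda>x. indicator (?G l) x * ?q k l x) = d * prob (?G l)" if "l \<in> {\<nu>..<L}" for k l
  proof -
    have l: "1 \<le> l" "\<theta> k l = \<mu> k" using that \<nu> \<theta> by auto
    have eq: "(\<lambda>x. indicator (?G l) x * ?q k l x) = (\<lambda>x. (indicator (?G l) x * (X k l x - \<theta> k l) ^ 4) * (d / 3))"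
      using l by (simp add: mult.assoc)
    show "integrable M (\<lambda>x. indicator (?G l) x * ?q k l x)"
      unfolding eq by (intro integrable_mult_left past_times_fourth_moment(1) l past that)
    show "expectation (\<lambda>x. indicator (?G l) x * ?q k l x) = d * prob (?G l)"
      unfolding eq integral_mult_left_zero past_times_fourth_moment(2)[OF l(1) past[OF that]] by simp
  qed
  have pt: "(\<Sum>l\<in>{\<nu>..<L}. \<Sum>k\<in>UNIV. indicator (?G l) x * ?z k l x)
     \<le> ln A + ?K + (\<Sum>l\<in>{\<nu>..<L}. \<Sum>k\<in>UNIV. indicator (?G l) x * ?q k l x)" if x: "x \<in> space M" for x
  proof -
    define g where "g l \<longleftrightarrow> x \<in> ?G l" for l
    have g_iff: "g l \<longleftrightarrow> (\<forall>n\<in>{\<nu>..<l}. (\<Sum>i\<in>{\<nu>..n}. \<Sum>k\<in>UNIV. ?z k i x) < ln A)" for l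
    proof -
      have "exp s < A \<longleftrightarrow> s < ln A" for s using A by (metis exp_less_cancel_iff exp_ln less_le_trans zero_less_one)
      then show ?thesis using x unfolding g_def running_def likelihood_ratio_exp by simp
    qed
    \<comment> \<open>The overshoot is bounded uniformly in the estimate, since \<open>h X - h\<^sup>2 / 2 \<le> X\<^sup>2 / 2\<close> for all \<open>h\<close>.\<close>
    have step: "(\<Sum>k\<in>UNIV. ?z k l x) \<le> ?K + (\<Sum>k\<in>UNIV. ?q k l x)" for l
      unfolding sum.distrib[symmetric]
    proof (rule sum_mono)
      fix k
      let ?u = "(X k l x - \<mu> k)\<^sup>2"
      have "?z k l x \<le> (X k l x)\<^sup>2 / 2"
        using zero_le_power2[of "X k l x - ?h k l x"] by (simp add: power2_eq_square algebra_simps)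
      also have "\<dots> \<le> ?u + (\<mu> k)\<^sup>2"
        using zero_le_power2[of "X k l x - 2 * \<mu> k"] by (simp add: power2_eq_square algebra_simps)
      also have "?u \<le> 3 / (4 * d) + ?u\<^sup>2 * (d / 3)"
      proof -
        have "v \<le> 3 / (4 * d) + v\<^sup>2 * (d / 3)" for v
        proof -
          have "0 \<le> (v * (2 * d / 3) - 1)\<^sup>2 * (3 / (4 * d))" using d by simp
          also have "\<dots> = 3 / (4 * d) + v\<^sup>2 * (d / 3) - v"
            using d by (simp add: field_simps power2_eq_square)
          finally show ?thesis by simp
        qed
        then show ?thesis .
      qed
      also have "?u\<^sup>2 = (X k l x - \<mu> k) ^ 4" by (simp add: power_mult[symmetric])
      finally show "?z k l x \<le> (\<mu> k)\<^sup>2 + 3 / (4 * d) + ?q k l x" by simp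
    qed
    have "(\<Sum>l\<in>{\<nu>..<L}. of_bool (g l) * (\<Sum>k\<in>UNIV. ?z k l x))
      \<le> ln A + ?K + (\<Sum>l\<in>{\<nu>..<L}. of_bool (g l) * (\<Sum>k\<in>UNIV. ?q k l x))"
      by (rule stopped_sum_bound[OF _ _ _ step g_iff \<nu>(2)]) (use A d in \<open>auto intro!: sum_nonneg\<close>)
    then show ?thesis unfolding g_def by (simp add: indicator_def sum_distrib_left)
  qed
  let ?S = "\<Sum>l\<in>{\<nu>..<L}. prob (?G l)"
  let ?e = "\<lambda>k l. expectation (\<lambda>x. (?h k l x - \<mu> k) ^ 4)"
  have "(\<Sum>l\<in>{\<nu>..<L}. \<Sum>k\<in>UNIV. ((\<mu> k)\<^sup>2 / 2 - d) * prob (?G l) - ?e k l / (16 * d))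
     \<le> (\<Sum>l\<in>{\<nu>..<L}. \<Sum>k\<in>UNIV. expectation (\<lambda>x. indicator (?G l) x * ?z k l x))"
    by (intro sum_mono zmean)
  also have "\<dots> = (\<Sum>l\<in>{\<nu>..<L}. expectation (\<lambda>x. \<Sum>k\<in>UNIV. indicator (?G l) x * ?z k l x))"
    by (intro sum.cong refl Bochner_Integration.integral_sum[symmetric] zint)
  also have "\<dots> = expectation (\<lambda>x. \<Sum>l\<in>{\<nu>..<L}. \<Sum>k\<in>UNIV. indicator (?G l) x * ?z k l x)"
    by (intro Bochner_Integration.integral_sum[symmetric] Bochner_Integration.integrable_sum zint)
  also have "\<dots> \<le> expectation (\<lambda>x. ln A + ?K + (\<Sum>l\<in>{\<nu>..<L}. \<Sum>k\<in>UNIV. indicator (?G l) x * ?q k l x))"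
    by (intro integral_mono Bochner_Integration.integrable_add Bochner_Integration.integrable_sum zint q(1) pt
        integrable_const)
  also have "\<dots> = expectation (\<lambda>x. ln A + ?K) + expectation (\<lambda>x. \<Sum>l\<in>{\<nu>..<L}. \<Sum>k\<in>UNIV. indicator (?G l) x * ?q k l x)"
    by (intro Bochner_Integration.integral_add Bochner_Integration.integrable_sum q(1) integrable_const)
  also have "expectation (\<lambda>x. ln A + ?K) = ln A + ?K" by (simp add: prob_space)
  also have "expectation (\<lambda>x. \<Sum>l\<in>{\<nu>..<L}. \<Sum>k\<in>UNIV. indicator (?G l) x * ?q k l x)
      = (\<Sum>l\<in>{\<nu>..<L}. expectation (\<lambda>x. \<Sum>k\<in>UNIV. indicator (?G l) x * ?q k l x))"
    by (intro Bochner_Integration.integral_sum Bochner_Integration.integrable_sum q(1))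
  also have "\<dots> = (\<Sum>l\<in>{\<nu>..<L}. \<Sum>k\<in>UNIV. expectation (\<lambda>x. indicator (?G l) x * ?q k l x))"
    by (intro sum.cong refl Bochner_Integration.integral_sum q(1))
  also have "\<dots> = (\<Sum>l\<in>{\<nu>..<L}. \<Sum>k\<in>(UNIV :: 'k set). d * prob (?G l))"
    by (intro sum.cong refl q(2))
  finally have main: "(\<Sum>l\<in>{\<nu>..<L}. \<Sum>k\<in>UNIV. ((\<mu> k)\<^sup>2 / 2 - d) * prob (?G l) - ?e k l / (16 * d))
     \<le> ln A + ?K + (\<Sum>l\<in>{\<nu>..<L}. \<Sum>k\<in>(UNIV :: 'k set). d * prob (?G l))" .
  have lhs: "(\<Sum>l\<in>{\<nu>..<L}. \<Sum>k\<in>UNIV. ((\<mu> k)\<^sup>2 / 2 - d) * prob (?G l) - ?e k l / (16 * d)) =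
     ((\<Sum>k\<in>UNIV. (\<mu> k)\<^sup>2) / 2 - real CARD('k) * d) * ?S - (\<Sum>k\<in>UNIV. \<Sum>l\<in>{\<nu>..<L}. ?e k l) / (16 * d)"
  proof -
    have "(\<Sum>k\<in>UNIV. ((\<mu> k)\<^sup>2 / 2 - d)) = (\<Sum>k\<in>UNIV. (\<mu> k)\<^sup>2) / 2 - real CARD('k) * d"
      by (simp add: sum_subtractf sum_divide_distrib)
    then have "(\<Sum>l\<in>{\<nu>..<L}. \<Sum>k\<in>UNIV. ((\<mu> k)\<^sup>2 / 2 - d) * prob (?G l)) =
       ((\<Sum>k\<in>UNIV. (\<mu> k)\<^sup>2) / 2 - real CARD('k) * d) * ?S"
      by (simp add: sum_distrib_right[symmetric] sum_distrib_left)
    moreover have "(\<Sum>l\<in>{\<nu>..<L}. \<Sum>k\<in>UNIV. ?e k l / (16 * d)) = (\<Sum>k\<in>UNIV. \<Sum>l\<in>{\<nu>..<L}. ?e k l) / (16 * d)"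
      by (subst sum.swap) (simp add: sum_divide_distrib)
    ultimately show ?thesis by (simp add: sum_subtractf)
  qed
  have rhs: "(\<Sum>l\<in>{\<nu>..<L}. \<Sum>k\<in>(UNIV :: 'k set). d * prob (?G l)) = real CARD('k) * d * ?S"
    by (simp add: sum_distrib_left mult.assoc)
  have "(\<Sum>k\<in>UNIV. \<Sum>l\<in>{\<nu>..<L}. ?e k l) / (16 * d) \<le> (\<Sum>k\<in>UNIV. ?c k) / (16 * d)"
    using d by (intro divide_right_mono sum_mono h4(2)) auto
  moreover have "(\<Sum>k\<in>UNIV. (\<mu> k)\<^sup>2 + 3 / (4 * d) + ?c k / (16 * d)) = ?K + (\<Sum>k\<in>UNIV. ?c k) / (16 * d)"
    by (subst sum.distrib) (simp only: sum_divide_distrib)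
  moreover have "((\<Sum>k\<in>UNIV. (\<mu> k)\<^sup>2) / 2 - 2 * real CARD('k) * d) * ?S =
      ((\<Sum>k\<in>UNIV. (\<mu> k)\<^sup>2) / 2 - real CARD('k) * d) * ?S - real CARD('k) * d * ?S"
    by (simp only: left_diff_distrib)
  ultimately show ?thesis using main unfolding lhs rhs by linarith
qed

end

section \<open>Conditional delay of the hard-thresholding scheme\<close>

context change_point_model
begin

text \<open>
  As long as the scheme runs, so does the one-sided test started at \<open>\<nu>\<close>. The test is independent of
  the observations before \<open>\<nu>\<close>, and these decide whether \<open>N \<ge> \<nu>\<close>; hence its expected duration bounds the
  conditional delay on every event of the past.
\<close>
theorem detection_delay_N_hard_le:
  assumes c: "\<And>\<nu>. 1 \<le> \<nu> \<Longrightarrow>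
      (\<Sum>t. emeasure (P \<mu> \<nu>) (gaussian_streams.running (P \<mu> \<nu>) X \<omega> A \<nu> (\<nu> + t))) \<le> c"
    and fin: "c \<noteq> \<infinity>"
  shows "detection_delay X (P \<mu>) (N_hard \<omega> X A) \<le> c"
  unfolding detection_delay_def Let_def
proof (rule SUP_least)
  fix \<nu> :: nat assume "\<nu> \<in> {1..}"
  then have \<nu>: "1 \<le> \<nu>" by simp
  interpret Q: gaussian_streams "P \<mu> \<nu>" X "\<lambda>k n. if n < \<nu> then 0 else \<mu> $ k" by (rule gaussian_P[OF \<nu>])
  let ?Q = "P \<mu> \<nu>" and ?N = "N_hard \<omega> X A"
  define E where "E = {x \<in> space ?Q. enat \<nu> \<le> ?N x}"
  define M where "M = uniform_measure ?Q E"
  have EF: "E \<in> sets (obs_filtration ?Q X (enat (\<nu> - 1)))"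
  proof -
    have "E = {x \<in> space ?Q. enat (\<nu> - 1) < ?N x}"
      unfolding E_def using \<nu> Suc_ile_eq[of "\<nu> - 1"] by simp
    then show ?thesis using stopping_time_sets(2)[OF stopping_time_N_hard] by metis
  qed
  have [measurable]: "E \<in> sets ?Q" by (rule Q.obs_sets[OF EF])
  have [simp]: "sets M = sets ?Q" "space M = space ?Q" unfolding M_def by simp_all
  interpret M: finite_measure M
  proof
    show "emeasure M (space M) \<noteq> \<infinity>"
      unfolding M_def by (cases "emeasure ?Q E = 0")
        (auto simp: Q.emeasure_eq_measure emeasure_uniform_measure divide_ennreal_def ennreal_mult_eq_top_iff)
  qed
  let ?F = "obs_filtration M X (enat (\<nu> - 1))"
  have FQ: "?F = obs_filtration ?Q X (enat (\<nu> - 1))" by (rule obs_filtration_cong) simp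
  interpret S: finite_measure_subalgebra M ?F
    unfolding FQ using Q.subalgebra_obs by unfold_locales (simp add: subalgebra_def)
  let ?f = "\<lambda>x. ?N x - enat \<nu> + 1"
  have fm: "?f \<in> measurable M (count_space UNIV)"
  proof -
    have "?f \<in> measurable ?Q (count_space UNIV)"
      by (rule measurable_compose[OF Q.stopping_time_measurable[OF stopping_time_N_hard]]) simp
    moreover have "measurable M (count_space UNIV) = measurable ?Q (count_space UNIV :: enat measure)"
      by (rule measurable_cong_sets) simp_all
    ultimately show ?thesis by simp
  qed
  have "esssup M (nn_cond_exp M ?F (\<lambda>x. ennreal_of_enat (?f x))) \<le> c"
  proof (rule S.esssup_cond_exp_le[OF _ fin])
    show "(\<lambda>x. ennreal_of_enat (?f x)) \<in> borel_measurable M"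
      by (rule measurable_compose[OF fm]) simp
    fix B assume B: "B \<in> sets ?F"
    have BQ [measurable]: "B \<in> sets ?Q" using B FQ Q.obs_sets by auto
    let ?g = "\<lambda>x. if x \<in> B then ?f x else 0"
    have gm: "?g \<in> measurable M (count_space UNIV)"
      using BQ fm by (intro measurable_If_set) auto
    have "(\<integral>\<^sup>+x\<in>B. ennreal_of_enat (?f x) \<partial>M) = (\<integral>\<^sup>+x. ennreal_of_enat (?g x) \<partial>M)"
      by (intro nn_integral_cong) (auto split: split_indicator)
    also have "\<dots> = (\<Sum>t. emeasure M {x \<in> space M. enat t < ?g x})"
      by (rule nn_integral_enat_function[OF gm])
    also have "\<dots> \<le> (\<Sum>t. emeasure M B * emeasure ?Q (Q.running \<omega> A \<nu> (\<nu> + t)))"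
    proof (intro suminf_le summableI)
      fix t
      let ?R = "Q.running \<omega> A \<nu> (\<nu> + t)"
      have RF: "?R \<in> sets (Q.future (\<nu> - 1))" by (rule Q.running_future[OF \<nu>])
      have RQ [measurable]: "?R \<in> sets ?Q" by (rule Q.sets_future_events[OF RF])
      \<comment> \<open>Where \<open>N < \<nu>\<close>, the difference \<open>N - \<nu>\<close> is truncated to 0 and only \<open>t = 0\<close> occurs; the event
          \<open>running\<close> is then the whole space.\<close>
      have sub: "{x \<in> space M. enat t < ?g x} \<subseteq> B \<inter> ?R"
      proof safe
        fix x assume x: "x \<in> space M" "enat t < ?g x"
        then show "x \<in> B" by (auto split: if_splits)
        have less: "enat t < ?N x - enat \<nu> + 1" using x(2) by (auto split: if_splits)
        have "likelihood_ratio \<omega> (\<lambda>k i. X k i x) n \<nu> < A" if n: "n \<in> {\<nu>..<\<nu> + t}" for n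
        proof -
          have "enat n < ?N x"
            using less n by (cases "?N x") (auto simp: one_enat_def)
          then have "SR_statistic \<omega> (\<lambda>k i. X k i x) n < A"
            unfolding N_hard_gt_iff using n \<nu> by auto
          then show ?thesis
            using likelihood_ratio_le_SR[of \<nu> n \<omega> "\<lambda>k i. X k i x"] n \<nu> by auto
        qed
        then show "x \<in> ?R" using x(1) unfolding Q.running_def by auto
      qed
      have "emeasure M {x \<in> space M. enat t < ?g x} \<le> emeasure M (B \<inter> ?R)"
        by (rule emeasure_mono[OF sub]) auto
      also have "\<dots> = emeasure ?Q ((E \<inter> B) \<inter> ?R) / emeasure ?Q E"
        unfolding M_def by (subst emeasure_uniform_measure) (auto simp: Int_assoc)
      also have "emeasure ?Q ((E \<inter> B) \<inter> ?R) = emeasure ?Q (E \<inter> B) * emeasure ?Q ?R"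
        using Q.indep_setD[OF Q.indep_past_future _ RF, of "E \<inter> B"] EF B FQ
        by (simp add: Q.emeasure_eq_measure ennreal_mult' sets.Int)
      also have "emeasure ?Q (E \<inter> B) * emeasure ?Q ?R / emeasure ?Q E = emeasure M B * emeasure ?Q ?R"
        unfolding M_def by (subst emeasure_uniform_measure) (auto simp: divide_ennreal_def mult_ac)
      finally show "emeasure M {x \<in> space M. enat t < ?g x} \<le> emeasure M B * emeasure ?Q ?R" .
    qed
    also have "\<dots> = emeasure M B * (\<Sum>t. emeasure ?Q (Q.running \<omega> A \<nu> (\<nu> + t)))"
      by simp
    also have "\<dots> \<le> emeasure M B * c" by (intro mult_left_mono c \<nu>) simp
    finally show "(\<integral>\<^sup>+x\<in>B. ennreal_of_enat (?f x) \<partial>M) \<le> c * emeasure M B" by (simp add: mult.commute)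
  qed
  then show "esssup (uniform_measure ?Q {x \<in> space ?Q. enat \<nu> \<le> ?N x})
      (nn_cond_exp (uniform_measure ?Q {x \<in> space ?Q. enat \<nu> \<le> ?N x})
        (obs_filtration (uniform_measure ?Q {x \<in> space ?Q. enat \<nu> \<le> ?N x}) X (enat (\<nu> - 1)))
        (\<lambda>x. ennreal_of_enat (?N x - enat \<nu> + 1))) \<le> c"
    unfolding M_def E_def .
qed

end

section \<open>First-order asymptotics\<close>

text \<open>
  An additive constant is negligible against \<open>ln A\<close>, so for large \<open>A\<close> the two bounds confine the ratio
  between 1 and any number above \<open>1 / (1 - \<epsilon>)\<^sup>2\<close>.
\<close>
lemma ennreal_ratio_tendsto_1:
  fixes f g :: "real \<Rightarrow> ennreal"
  assumes I: "0 < I" and le: "eventually (\<lambda>A. g A \<le> f A) at_top"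
    and up: "\<And>\<epsilon>. 0 < \<epsilon> \<Longrightarrow> \<epsilon> < 1 \<Longrightarrow> \<exists>C. eventually (\<lambda>A. f A \<le> ennreal ((ln A + C) / ((1 - \<epsilon>) * I))) at_top"
    and low: "\<And>\<epsilon>. 0 < \<epsilon> \<Longrightarrow> \<epsilon> < 1 \<Longrightarrow> eventually (\<lambda>A. ennreal ((1 - \<epsilon>) * ln A / I) \<le> g A) at_top"
  shows "((\<lambda>A. f A / g A) \<longlongrightarrow> 1) at_top"
proof -
  have ln_pos: "eventually (\<lambda>A::real. 0 < ln A) at_top" by real_asymp
  have quotient: "(y + C) / (e * I) / (e * y / I) = (1 + C / y) * (1 / e\<^sup>2)" if "0 < y" "0 < e" for y e C
    using that I by (simp add: field_simps power2_eq_square)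
  have upper: "eventually (\<lambda>A. f A / g A \<le> ennreal r) at_top" if r: "1 < r" for r
  proof -
    \<comment> \<open>With this choice \<open>1 - 2 \<epsilon> = 1 / r\<close>, so that \<open>1 / (1 - \<epsilon>)\<^sup>2 < r\<close>.\<close>
    define \<epsilon> where "\<epsilon> = (r - 1) / (2 * r)"
    have \<epsilon>: "0 < \<epsilon>" "\<epsilon> < 1" using r unfolding \<epsilon>_def by (auto simp: field_simps)
    have "1 / r = 1 - 2 * \<epsilon>" using r unfolding \<epsilon>_def by (simp add: field_simps)
    also have "\<dots> < (1 - \<epsilon>)\<^sup>2" using \<epsilon> by (simp add: power2_eq_square algebra_simps)
    finally have lt: "1 / (1 - \<epsilon>)\<^sup>2 < r" using r \<epsilon> by (simp add: field_simps)
    obtain C where C: "eventually (\<lambda>A. f A \<le> ennreal ((ln A + C) / ((1 - \<epsilon>) * I))) at_top"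
      using up[OF \<epsilon>] by blast
    have "((\<lambda>A. (1 + C / ln A) * (1 / (1 - \<epsilon>)\<^sup>2)) \<longlongrightarrow> (1 + 0) * (1 / (1 - \<epsilon>)\<^sup>2)) at_top"
      by (intro tendsto_intros) real_asymp
    then have "eventually (\<lambda>A. (1 + C / ln A) * (1 / (1 - \<epsilon>)\<^sup>2) < r) at_top"
      using lt by (intro order_tendstoD) auto
    then show ?thesis using C low[OF \<epsilon>] ln_pos
    proof eventually_elim
      case (elim A)
      let ?U = "(ln A + C) / ((1 - \<epsilon>) * I)" and ?L = "(1 - \<epsilon>) * ln A / I"
      have L: "0 < ?L" using elim(4) \<epsilon> I by simp
      have "?U / ?L = (1 + C / ln A) * (1 / (1 - \<epsilon>)\<^sup>2)"
        using quotient[of "ln A" "1 - \<epsilon>" C] elim(4) \<epsilon> by simp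
      with elim(1) have "?U / ?L < r" by simp
      then have "?U \<le> ?L * r"
        using pos_divide_less_eq[OF L, of ?U r] by (simp add: mult.commute)
      then have "ennreal ?U \<le> ennreal ?L * ennreal r"
        using L by (simp add: ennreal_mult'[symmetric] ennreal_leI)
      also have "\<dots> \<le> g A * ennreal r" using elim(3) by (intro mult_right_mono) auto
      finally have "f A \<le> g A * ennreal r" using elim(2) by (rule order_trans[rotated])
      moreover have "0 < g A" using L elim(3) by (auto intro: less_le_trans[rotated])
      ultimately show ?case by (intro divide_le_posI_ennreal)
    qed
  qed
  have lower: "eventually (\<lambda>A. 1 \<le> f A / g A) at_top"
  proof -
    obtain C where "eventually (\<lambda>A. f A \<le> ennreal ((ln A + C) / ((1 - 1/2) * I))) at_top"
      using up[of "1/2"] by auto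
    then show ?thesis using low[of "1/2", simplified] le ln_pos
    proof eventually_elim
      case (elim A)
      have "0 < ennreal (ln A / (2 * I))" using elim(4) I by simp
      also have "\<dots> \<le> g A" using elim(2) by simp
      finally have "g A \<noteq> 0" by simp
      moreover have "g A \<noteq> \<top>" using elim(1,3) by (auto simp: top_unique)
      ultimately have "1 = g A / g A" by (simp add: ennreal_divide_self less_top)
      also have "\<dots> \<le> f A / g A" using elim(3) by (rule divide_right_mono_ennreal)
      finally show ?case .
    qed
  qed
  show ?thesis
  proof (rule order_tendstoI)
    fix a :: ennreal assume "a < 1"
    with lower show "eventually (\<lambda>A. a < f A / g A) at_top"
      by (auto elim: eventually_mono intro: less_le_trans)
  next
    fix a :: ennreal assume "1 < a"
    then obtain b where b: "1 < b" "b < a" using dense by blast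
    then obtain r where r: "b = ennreal r" "1 < r"
      by (cases b) auto
    from upper[OF r(2)] show "eventually (\<lambda>A. f A / g A < a) at_top"
      using b(2) r(1) by (auto elim: eventually_mono intro: le_less_trans)
  qed
qed

lemma information_pos: "\<mu> \<noteq> 0 \<Longrightarrow> 0 < information \<mu>"
proof -
  assume "\<mu> \<noteq> 0"
  then obtain k where "\<mu> $ k \<noteq> 0" by (auto simp: vec_eq_iff)
  then have "0 < (\<Sum>k\<in>UNIV. (\<mu> $ k)\<^sup>2)" by (intro sum_pos2[of _ k]) auto
  then show ?thesis by (simp add: information_def)
qed

lemma post_change_setD:
  assumes "\<mu> \<in> post_change_set \<omega>"
  shows "\<mu> \<noteq> 0" "\<mu> $ k = 0 \<or> \<omega> k < \<bar>\<mu> $ k\<bar>"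
  using assms unfolding post_change_set_def
  by (auto simp: sum_nonneg_eq_0_iff)

context change_point_model
begin

text \<open>
  The bound for fixed \<open>m\<close> is used with \<open>m\<close> close to \<open>(1 - e) ln A / I\<close>, \<open>c = (1 + e) I m\<close> and \<open>s = e / 2\<close>. Then
  \<open>c \<le> (1 - e\<^sup>2) ln A\<close>, so the first error term is at most \<open>2 m exp (- e\<^sup>2 ln A)\<close>, and the exponent of the
  second is \<open>s (s - e) I m = - e\<^sup>2 I m / 4\<close>; both terms tend to 0.
\<close>
lemma asymptotic_lower_bound:
  assumes \<mu>: "\<mu> \<noteq> 0" and \<epsilon>: "0 < \<epsilon>" "\<epsilon> < 1"
  shows "eventually (\<lambda>A. \<forall>T. stopping_time (obs_filtration Pinf X) T \<longrightarrow>
      ennreal A \<le> (\<integral>\<^sup>+x. ennreal_of_enat (T x) \<partial>Pinf) \<longrightarrow>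
      ennreal ((1 - \<epsilon>) * ln A / information \<mu>) \<le> detection_delay X (P \<mu>) T) at_top"
proof -
  define I where "I = information \<mu>"
  define e where "e = \<epsilon> / 2"
  have I: "0 < I" unfolding I_def using \<mu> by (rule information_pos)
  have e: "0 < e" "e < 1" "1 - \<epsilon> < 1 - e" "0 < 1 - e" using \<epsilon> unfolding e_def by auto
  \<comment> \<open>A lower bound for the conditional probability of surviving \<open>m\<close> steps.\<close>
  define h where "h A = 1 - 2 * ((1 - e) * ln A / I) * exp (- e\<^sup>2 * ln A) - exp (- (e\<^sup>2 / 4 * ((1 - e) * ln A - I)))" for A
  have h: "(h \<longlongrightarrow> 1) at_top"
    unfolding h_def using e I by real_asymp
  have r: "((\<lambda>A::real. ((1 - e) * ln A / I - 1) / ln A) \<longlongrightarrow> (1 - e) * inverse I) at_top"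
    using e I by real_asymp
  have "((\<lambda>A. ((1 - e) * ln A / I - 1) / ln A * h A) \<longlongrightarrow> (1 - e) / I * 1) at_top"
    unfolding divide_inverse[of "1 - e"] by (intro tendsto_mult h r)
  then have 1: "eventually (\<lambda>A. (1 - \<epsilon>) / I < ((1 - e) * ln A / I - 1) / ln A * h A) at_top"
    using e(3) I by (intro order_tendstoD) (auto simp: divide_strict_right_mono)
  have 2: "eventually (\<lambda>A. 0 < h A) at_top" using h by (intro order_tendstoD) auto
  have 3: "eventually (\<lambda>A. 1 \<le> (1 - e) * ln A / I) at_top" using e I by real_asymp
  have 4: "eventually (\<lambda>A::real. 1 < A) at_top" by (rule eventually_gt_at_top)
  from 1 2 3 4 show ?thesis
  proof eventually_elim
    case (elim A)
    let ?y = "(1 - e) * ln A / I"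
    define m where "m = nat \<lfloor>?y\<rfloor>"
    have m: "0 < m" "real m \<le> ?y" "?y - 1 \<le> real m"
      using elim(3) unfolding m_def by linarith+
    have lnA: "0 < ln A" using elim(4) by simp
    define c where "c = (1 + e) * I * real m"
    have Im: "I * real m \<le> (1 - e) * ln A" "(1 - e) * ln A - I \<le> I * real m"
      using m(2,3) I by (simp_all add: field_simps)
    have c: "c - ln A \<le> - e\<^sup>2 * ln A"
      using mult_left_mono[OF Im(1), of "1 + e"] e unfolding c_def by (simp add: algebra_simps power2_eq_square)
    have "exp c * (2 * real m / A) = 2 * real m * exp (c - ln A)"
      using elim(4) by (simp add: exp_diff)
    also have "\<dots> \<le> 2 * ?y * exp (- e\<^sup>2 * ln A)"
      using m(2) c by (intro mult_mono) auto
    finally have a: "exp c * (2 * real m / A) \<le> 2 * ?y * exp (- e\<^sup>2 * ln A)" .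
    have "(e / 2 + (e / 2)\<^sup>2) * real m * I - e / 2 * c = - (e\<^sup>2 / 4 * (I * real m))"
      unfolding c_def by (simp add: power2_eq_square algebra_simps add_divide_distrib diff_divide_distrib)
    also have "\<dots> \<le> - (e\<^sup>2 / 4 * ((1 - e) * ln A - I))"
      using Im(2) by (simp add: mult_left_mono)
    finally have b: "exp ((e / 2 + (e / 2)\<^sup>2) * real m * I - e / 2 * c) \<le> exp (- (e\<^sup>2 / 4 * ((1 - e) * ln A - I)))"
      by simp
    have "(1 - \<epsilon>) * ln A / I = (1 - \<epsilon>) / I * ln A" by simp
    also have "\<dots> \<le> (?y - 1) / ln A * h A * ln A"
      using elim(1) lnA by (intro mult_right_mono) auto
    also have "\<dots> = (?y - 1) * h A" using lnA by simp
    also have "\<dots> \<le> real m * h A" using m(3) elim(2) by (intro mult_right_mono) auto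
    also have "\<dots> \<le> real m * (1 - exp c * (2 * real m / A) - exp ((e / 2 + (e / 2)\<^sup>2) * real m * I - e / 2 * c))"
    proof (rule mult_left_mono)
      show "h A \<le> 1 - exp c * (2 * real m / A) - exp ((e / 2 + (e / 2)\<^sup>2) * real m * I - e / 2 * c)"
        using a b unfolding h_def by linarith
    qed simp
    finally have main: "(1 - \<epsilon>) * ln A / I \<le> \<dots>" .
    show ?case
    proof (intro allI impI)
      fix T assume T: "stopping_time (obs_filtration Pinf X) T" "ennreal A \<le> (\<integral>\<^sup>+x. ennreal_of_enat (T x) \<partial>Pinf)"
      have "ennreal (real m * (1 - exp c * (2 * real m / A) - exp ((e / 2 + (e / 2)\<^sup>2) * real m * information \<mu> - e / 2 * c)))
        \<le> detection_delay X (P \<mu>) T"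
        using elim(4) e m(1) T by (intro detection_delay_lower_bound) auto
      with ennreal_leI[OF main] show "ennreal ((1 - \<epsilon>) * ln A / information \<mu>) \<le> detection_delay X (P \<mu>) T"
        unfolding I_def by (rule order_trans)
    qed
  qed
qed

text \<open>
  The loss \<open>d\<close> per stream and step is chosen such that the slope becomes \<open>(1 - \<epsilon>) I\<close>.
\<close>
lemma asymptotic_upper_bound:
  assumes \<omega>: "\<And>k. 0 < \<omega> k" and \<mu>: "\<mu> \<in> post_change_set \<omega>" and \<epsilon>: "0 < \<epsilon>" "\<epsilon> < 1"
  shows "\<exists>C. \<forall>A\<ge>1. detection_delay X (P \<mu>) (N_hard \<omega> X A) \<le> ennreal ((ln A + C) / ((1 - \<epsilon>) * information \<mu>))"
proof -
  let ?I = "information \<mu>"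
  have I: "0 < ?I" using post_change_setD(1)[OF \<mu>] by (rule information_pos)
  define d where "d = \<epsilon> * ?I / (2 * real CARD('k))"
  have d: "0 < d" unfolding d_def using \<epsilon> I by simp
  define C where "C = (\<Sum>k\<in>UNIV. (\<mu> $ k)\<^sup>2 + 3 / (4 * d) +
    ((\<mu> $ k) ^ 4 + 6 * (1 + \<bar>\<mu> $ k\<bar> / \<bar>\<bar>\<mu> $ k\<bar> - \<omega> k\<bar>) ^ 4) / (16 * d))"
  have Id: "?I - 2 * real CARD('k) * d = (1 - \<epsilon>) * ?I"
    unfolding d_def by (simp add: field_simps)
  have pos: "0 < (1 - \<epsilon>) * ?I" using \<epsilon> I by simp
  have "detection_delay X (P \<mu>) (N_hard \<omega> X A) \<le> ennreal ((ln A + C) / ((1 - \<epsilon>) * ?I))" if A: "1 \<le> A" for A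
  proof (rule detection_delay_N_hard_le)
    fix \<nu> :: nat assume \<nu>: "1 \<le> \<nu>"
    interpret Q: gaussian_streams "P \<mu> \<nu>" X "\<lambda>k n. if n < \<nu> then 0 else \<mu> $ k" by (rule gaussian_P[OF \<nu>])
    have "(\<Sum>t<n. emeasure (P \<mu> \<nu>) (Q.running \<omega> A \<nu> (\<nu> + t))) \<le> ennreal ((ln A + C) / ((1 - \<epsilon>) * ?I))" for n
    proof -
      let ?S = "\<Sum>l\<in>{\<nu>..<\<nu> + n}. measure (P \<mu> \<nu>) (Q.running \<omega> A \<nu> l)"
      have "((\<Sum>k\<in>UNIV. (\<mu> $ k)\<^sup>2) / 2 - 2 * real CARD('k) * d) * ?S \<le> ln A + C"
        unfolding C_def using \<omega> post_change_setD(2)[OF \<mu>] \<nu> A d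
        by (intro Q.expected_running_time_bound) auto
      then have "?S \<le> (ln A + C) / ((1 - \<epsilon>) * ?I)"
        using pos unfolding information_def[symmetric] Id by (simp add: field_simps)
      moreover have "?S = (\<Sum>t<n. measure (P \<mu> \<nu>) (Q.running \<omega> A \<nu> (\<nu> + t)))"
        using sum.shift_bounds_nat_ivl[of "\<lambda>l. measure (P \<mu> \<nu>) (Q.running \<omega> A \<nu> l)" 0 \<nu> n]
        by (simp add: lessThan_atLeast0 add.commute)
      ultimately show ?thesis
        by (simp add: Q.emeasure_eq_measure sum_ennreal ennreal_leI)
    qed
    then show "(\<Sum>t. emeasure (P \<mu> \<nu>) (Q.running \<omega> A \<nu> (\<nu> + t))) \<le> ennreal ((ln A + C) / ((1 - \<epsilon>) * ?I))"
      by (intro suminf_le_const summableI)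
  qed simp
  then show ?thesis by blast
qed

end

theorem corollary2:
  fixes X :: "'k::finite \<Rightarrow> nat \<Rightarrow> 'a \<Rightarrow> real"
    and P :: "real ^ 'k \<Rightarrow> nat \<Rightarrow> 'a measure"
    and Pinf :: "'a measure"
    and \<omega> :: "'k \<Rightarrow> real"
  assumes "change_point_model X P Pinf"
    and "\<And>k. 0 < \<omega> k"
  shows "(\<forall>A>0. ennreal A \<le> (\<integral>\<^sup>+ x. ennreal_of_enat (N_hard \<omega> X A x) \<partial>Pinf)) \<and>
    (\<forall>\<mu>\<in>post_change_set \<omega>.
       ((\<lambda>A::real.
           detection_delay X (P \<mu>) (N_hard \<omega> X A) /
           (INF T\<in>{T. stopping_time (obs_filtration Pinf X) T \<and>
                       ennreal A \<le> (\<integral>\<^sup>+ x. ennreal_of_enat (T x) \<partial>Pinf)}.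
              detection_delay X (P \<mu>) T))
        \<longlongrightarrow> 1) at_top)"
proof -
  interpret change_point_model X P Pinf by fact
  interpret Pinf: gaussian_streams Pinf X "\<lambda>k n. 0" by (rule gaussian_Pinf)
  have false_alarm: "ennreal A \<le> (\<integral>\<^sup>+ x. ennreal_of_enat (N_hard \<omega> X A x) \<partial>Pinf)" if "0 < A" for A
    using that by (rule Pinf.N_hard_false_alarm[OF refl])
  have "((\<lambda>A. detection_delay X (P \<mu>) (N_hard \<omega> X A) /
      (INF T\<in>{T. stopping_time (obs_filtration Pinf X) T \<and>
         ennreal A \<le> (\<integral>\<^sup>+ x. ennreal_of_enat (T x) \<partial>Pinf)}. detection_delay X (P \<mu>) T)) \<longlongrightarrow> 1) at_top"
    if \<mu>: "\<mu> \<in> post_change_set \<omega>" for \<mu>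
  proof (rule ennreal_ratio_tendsto_1[OF information_pos[OF post_change_setD(1)[OF \<mu>]]])
    show "eventually (\<lambda>A. (INF T\<in>{T. stopping_time (obs_filtration Pinf X) T \<and>
         ennreal A \<le> (\<integral>\<^sup>+ x. ennreal_of_enat (T x) \<partial>Pinf)}. detection_delay X (P \<mu>) T)
        \<le> detection_delay X (P \<mu>) (N_hard \<omega> X A)) at_top"
      using eventually_gt_at_top[of 0]
      by eventually_elim (auto intro!: INF_lower stopping_time_N_hard false_alarm)
  next
    fix \<epsilon> :: real assume \<epsilon>: "0 < \<epsilon>" "\<epsilon> < 1"
    show "\<exists>C. eventually (\<lambda>A. detection_delay X (P \<mu>) (N_hard \<omega> X A)
        \<le> ennreal ((ln A + C) / ((1 - \<epsilon>) * information \<mu>))) at_top"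
      using asymptotic_upper_bound[OF assms(2) \<mu> \<epsilon>] eventually_ge_at_top[of "1 :: real"]
      by (metis (mono_tags, lifting) eventually_mono)
    show "eventually (\<lambda>A. ennreal ((1 - \<epsilon>) * ln A / information \<mu>) \<le>
        (INF T\<in>{T. stopping_time (obs_filtration Pinf X) T \<and>
         ennreal A \<le> (\<integral>\<^sup>+ x. ennreal_of_enat (T x) \<partial>Pinf)}. detection_delay X (P \<mu>) T)) at_top"
      using asymptotic_lower_bound[OF post_change_setD(1)[OF \<mu>] \<epsilon>]
      by eventually_elim (auto intro!: INF_greatest)
  qed
  with false_alarm show ?thesis by blast
qed

end
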